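(* Let $1<p<\infty$, let $\mathbb M$ be a Riemannian manifold of dimension $n$, let $\varepsilon>0$, let $h\in C^\infty([0,\infty))$, and let $v$ be a smooth solution of $v_t=L_\varepsilon v+h(|\nabla v|^2)$ on $\mathbb M\times(0,T]$. With $s=|\nabla v|^2$, $\sigma=s+\varepsilon^2$ and $w:=-L_\varepsilon v=h(s)-v_t$, define $$\mathcal Q_\varepsilon:=a^{ij}_\varepsilon\,\nabla_{ki}v\,\nabla_{kj}v=|\nabla^2v|^2+(p-2)\frac{|\nabla^2v(\nabla v)|^2}{\sigma},\qquad B_\varepsilon:=\frac{\nabla^2v(\nabla v)}{\sigma}-\frac{\nabla^2v(\nabla v,\nabla v)}{\sigma^2}\,\nabla v,$$ and the (smooth) drift field $$A_\varepsilon:=h'(s)\nabla v+(p-2)B_\varepsilon.$$ Then, at every point of $\mathbb M\times(0,T]$, $$L_\varepsilon w-w_t=2h'(s)\big[\mathcal Q_\varepsilon+\operatorname{Ric}(\nabla v,\nabla v)\big]+h''(s)\,a^{ij}_\varepsilon\,s_is_j-2\langle\nabla w,A_\varepsilon\rangle.$$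
   Context: The metric $g$ is independent of time. Notation: $a^{ij}_\varepsilon=g^{ij}+(p-2)\frac{\nabla^iv\,\nabla^jv}{\sigma}$ and $L_\varepsilon\phi=a^{ij}_\varepsilon\nabla_{ij}\phi$, where $\nabla_{ij}\phi$ are the components of the Hessian $\nabla^2\phi$; $s_i=\nabla_is$; $\nabla^2v(\nabla v)$ denotes the vector obtained by applying the Hessian, as an endomorphism, to $\nabla v$; repeated indices are summed (in a local orthonormal frame), and $|\nabla^2v|$ is the Hilbert-Schmidt norm. *)

theory Defs
  imports "HOL-Analysis.Analysis"
begin

section \<open>Smooth functions\<close>

text \<open>\<open>Ck_on k W f\<close> is meant for open \<open>W\<close>: \<open>f\<close> is of class \<open>C\<^sup>k\<close> on \<open>W\<close>.\<close>

primrec Ck_on :: "nat \<Rightarrow> 'a::euclidean_space set \<Rightarrow> ('a \<Rightarrow> 'b::real_normed_vector) \<Rightarrow> bool" where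
  "Ck_on 0 W f \<longleftrightarrow> continuous_on W f"
| "Ck_on (Suc k) W f \<longleftrightarrow>
     (\<forall>x\<in>W. f differentiable (at x)) \<and>
     (\<forall>b\<in>Basis. Ck_on k W (\<lambda>x. frechet_derivative f (at x) b))"

text \<open>On a set that need not be open (such as \<open>[0,\<infinity>)\<close> or \<open>V \<times> (0,T]\<close>), smoothness means that
  every point of the set has an open neighbourhood on which some \<open>C\<^sup>\<infinity>\<close> function agrees with
  \<open>f\<close> on the set; for open sets this is the usual notion.\<close>

definition smooth_on :: "'a::euclidean_space set \<Rightarrow> ('a \<Rightarrow> 'b::real_normed_vector) \<Rightarrow> bool" where
  "smooth_on S f \<longleftrightarrow>
     (\<forall>x\<in>S. \<exists>W F. open W \<and> x \<in> W \<and> (\<forall>k. Ck_on k W F) \<and> (\<forall>y\<in>W \<inter> S. F y = f y))"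

section \<open>Charts and Riemannian manifolds\<close>

text \<open>A chart is a coordinate domain together with its coordinate map; the dimension of the
  manifold is \<open>CARD('n)\<close>.\<close>

type_synonym ('a, 'n) chart = "'a set \<times> ('a \<Rightarrow> real^'n)"

abbreviation cdom :: "('a, 'n) chart \<Rightarrow> 'a set" where "cdom \<equiv> fst"
abbreviation cmap :: "('a, 'n) chart \<Rightarrow> 'a \<Rightarrow> real^'n" where "cmap \<equiv> snd"
abbreviation cimg :: "('a, 'n) chart \<Rightarrow> (real^'n) set" where "cimg c \<equiv> cmap c ` cdom c"

definition cinv :: "('a, 'n) chart \<Rightarrow> real^'n \<Rightarrow> 'a" where
  "cinv c = inv_into (cdom c) (cmap c)"

text \<open>\<open>pd c i u x\<close> is the coordinate derivative \<open>\<partial>u/\<partial>x\<^sup>i\<close> at the point \<open>x\<close> in the chart \<open>c\<close>,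
  again regarded as a function on the manifold.\<close>

definition pd :: "('a, 'n::finite) chart \<Rightarrow> 'n \<Rightarrow> ('a \<Rightarrow> real) \<Rightarrow> 'a \<Rightarrow> real" where
  "pd c i u x = frechet_derivative (u \<circ> cinv c) (at (cmap c x)) (axis i 1)"

definition is_chart :: "'a topology \<Rightarrow> ('a, 'n::finite) chart \<Rightarrow> bool" where
  "is_chart X c \<longleftrightarrow>
     openin X (cdom c) \<and> open (cimg c) \<and>
     homeomorphic_map (subtopology X (cdom c)) (top_of_set (cimg c)) (cmap c)"

locale smooth_manifold =
  fixes X :: "'a topology" and \<A> :: "('a, 'n::finite) chart set"
  assumes Hausdorff: "Hausdorff_space X"
    and second_countable: "\<exists>\<B>. countable \<B> \<and> (\<forall>B\<in>\<B>. openin X B) \<and>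
          (\<forall>W. openin X W \<longrightarrow> (\<exists>\<U>. \<U> \<subseteq> \<B> \<and> \<Union>\<U> = W))"
    and charts: "c \<in> \<A> \<Longrightarrow> is_chart X c"
    and cover: "(\<Union>c\<in>\<A>. cdom c) = topspace X"
    and transition: "c \<in> \<A> \<Longrightarrow> d \<in> \<A> \<Longrightarrow>
          smooth_on (cmap c ` (cdom c \<inter> cdom d)) (cmap d \<circ> cinv c)"

text \<open>The metric is given as a covariant 2-tensor: \<open>g c x\<close> is the matrix \<open>(g\<^sub>i\<^sub>j)\<close> of its components
  at \<open>x\<close> in the chart \<open>c\<close>. It does not depend on time.\<close>

type_synonym ('a, 'n) metric = "('a, 'n) chart \<Rightarrow> 'a \<Rightarrow> real^'n^'n"

definition ip :: "('a, 'n::finite) metric \<Rightarrow> ('a, 'n) chart \<Rightarrow> 'a \<Rightarrow> real^'n \<Rightarrow> real^'n \<Rightarrow> real" where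
  "ip g c x Y Z = (\<Sum>i\<in>UNIV. \<Sum>j\<in>UNIV. g c x $ i $ j * Y $ i * Z $ j)"

locale riemannian_manifold = smooth_manifold X \<A>
  for X :: "'a topology" and \<A> :: "('a, 'n::finite) chart set" +
  fixes g :: "('a, 'n) metric"
  assumes metric_smooth: "c \<in> \<A> \<Longrightarrow> smooth_on (cimg c) (g c \<circ> cinv c)"
    and metric_sym: "c \<in> \<A> \<Longrightarrow> x \<in> cdom c \<Longrightarrow> transpose (g c x) = g c x"
    and metric_pos: "c \<in> \<A> \<Longrightarrow> x \<in> cdom c \<Longrightarrow> Y \<noteq> 0 \<Longrightarrow> ip g c x Y Y > 0"
    and metric_tensor: "c \<in> \<A> \<Longrightarrow> d \<in> \<A> \<Longrightarrow> x \<in> cdom c \<inter> cdom d \<Longrightarrow>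
          g c x $ i $ j =
            (\<Sum>k\<in>UNIV. \<Sum>l\<in>UNIV.
               pd c i (\<lambda>y. cmap d y $ k) x * pd c j (\<lambda>y. cmap d y $ l) x * g d x $ k $ l)"

section \<open>Levi-Civita calculus in a chart\<close>

definition ginv :: "('a, 'n::finite) metric \<Rightarrow> ('a, 'n) chart \<Rightarrow> 'a \<Rightarrow> real^'n^'n" where
  "ginv g c x = matrix_inv (g c x)"

text \<open>\<open>christoffel g c k i j\<close> is \<open>\<Gamma>\<^sup>k\<^sub>i\<^sub>j\<close>.\<close>

definition christoffel ::
  "('a, 'n::finite) metric \<Rightarrow> ('a, 'n) chart \<Rightarrow> 'n \<Rightarrow> 'n \<Rightarrow> 'n \<Rightarrow> 'a \<Rightarrow> real" where
  "christoffel g c k i j x = (1/2) * (\<Sum>l\<in>UNIV. ginv g c x $ k $ l *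
     (pd c i (\<lambda>y. g c y $ j $ l) x + pd c j (\<lambda>y. g c y $ i $ l) x - pd c l (\<lambda>y. g c y $ i $ j) x))"

text \<open>\<open>riem g c l k i j\<close> is the component \<open>R\<^sup>l\<^sub>k\<^sub>i\<^sub>j\<close> of
  \<open>R(\<partial>\<^sub>i,\<partial>\<^sub>j)\<partial>\<^sub>k = \<nabla>\<^sub>i\<nabla>\<^sub>j\<partial>\<^sub>k - \<nabla>\<^sub>j\<nabla>\<^sub>i\<partial>\<^sub>k\<close>, and \<open>Ric(Y,Z)\<close> is the trace of \<open>V \<mapsto> R(V,Y)Z\<close>, so that round
  spheres have positive Ricci curvature.\<close>

definition riem ::
  "('a, 'n::finite) metric \<Rightarrow> ('a, 'n) chart \<Rightarrow> 'n \<Rightarrow> 'n \<Rightarrow> 'n \<Rightarrow> 'n \<Rightarrow> 'a \<Rightarrow> real" where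
  "riem g c l k i j x =
     pd c i (christoffel g c l j k) x - pd c j (christoffel g c l i k) x
     + (\<Sum>m\<in>UNIV. christoffel g c l i m x * christoffel g c m j k x
                   - christoffel g c l j m x * christoffel g c m i k x)"

definition Ric :: "('a, 'n::finite) metric \<Rightarrow> ('a, 'n) chart \<Rightarrow> 'a \<Rightarrow> real^'n \<Rightarrow> real^'n \<Rightarrow> real" where
  "Ric g c x Y Z = (\<Sum>j\<in>UNIV. \<Sum>k\<in>UNIV. (\<Sum>i\<in>UNIV. riem g c i k i j x) * Y $ j * Z $ k)"

definition grad ::
  "('a, 'n::finite) metric \<Rightarrow> ('a, 'n) chart \<Rightarrow> ('a \<Rightarrow> real) \<Rightarrow> 'a \<Rightarrow> real^'n" where
  "grad g c u x = (\<chi> i. \<Sum>j\<in>UNIV. ginv g c x $ i $ j * pd c j u x)"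

text \<open>\<open>hess g c i j u\<close> is the covariant component \<open>\<nabla>\<^sub>i\<^sub>j u\<close>.\<close>

definition hess ::
  "('a, 'n::finite) metric \<Rightarrow> ('a, 'n) chart \<Rightarrow> 'n \<Rightarrow> 'n \<Rightarrow> ('a \<Rightarrow> real) \<Rightarrow> 'a \<Rightarrow> real" where
  "hess g c i j u x = pd c i (pd c j u) x - (\<Sum>k\<in>UNIV. christoffel g c k i j x * pd c k u x)"

definition hess_bil ::
  "('a, 'n::finite) metric \<Rightarrow> ('a, 'n) chart \<Rightarrow> ('a \<Rightarrow> real) \<Rightarrow> 'a \<Rightarrow> real^'n \<Rightarrow> real^'n \<Rightarrow> real" where
  "hess_bil g c u x Y Z = (\<Sum>i\<in>UNIV. \<Sum>j\<in>UNIV. hess g c i j u x * Y $ i * Z $ j)"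

text \<open>The Hessian as an endomorphism: one index is raised with the metric.\<close>

definition hess_end ::
  "('a, 'n::finite) metric \<Rightarrow> ('a, 'n) chart \<Rightarrow> ('a \<Rightarrow> real) \<Rightarrow> 'a \<Rightarrow> real^'n \<Rightarrow> real^'n" where
  "hess_end g c u x Y =
     (\<chi> i. \<Sum>j\<in>UNIV. \<Sum>k\<in>UNIV. ginv g c x $ i $ j * hess g c j k u x * Y $ k)"

text \<open>Sums over repeated indices in an orthonormal frame become, in arbitrary coordinates,
  contractions with \<open>g\<^sup>i\<^sup>j\<close>; here for the squared Hilbert-Schmidt norm of the Hessian.\<close>

definition hess_norm2 ::
  "('a, 'n::finite) metric \<Rightarrow> ('a, 'n) chart \<Rightarrow> ('a \<Rightarrow> real) \<Rightarrow> 'a \<Rightarrow> real" where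
  "hess_norm2 g c u x =
     (\<Sum>i\<in>UNIV. \<Sum>j\<in>UNIV. \<Sum>k\<in>UNIV. \<Sum>l\<in>UNIV.
        ginv g c x $ i $ k * ginv g c x $ j $ l * hess g c i j u x * hess g c k l u x)"

section \<open>The regularised operator\<close>

definition sfun ::
  "('a, 'n::finite) metric \<Rightarrow> ('a, 'n) chart \<Rightarrow> ('a \<Rightarrow> real) \<Rightarrow> 'a \<Rightarrow> real" where
  "sfun g c u x = ip g c x (grad g c u x) (grad g c u x)"

definition sigma_reg ::
  "('a, 'n::finite) metric \<Rightarrow> ('a, 'n) chart \<Rightarrow> real \<Rightarrow> ('a \<Rightarrow> real) \<Rightarrow> 'a \<Rightarrow> real" where
  "sigma_reg g c \<epsilon> u x = sfun g c u x + \<epsilon>\<^sup>2"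

definition acoef ::
  "('a, 'n::finite) metric \<Rightarrow> ('a, 'n) chart \<Rightarrow> real \<Rightarrow> real \<Rightarrow> ('a \<Rightarrow> real) \<Rightarrow> 'n \<Rightarrow> 'n \<Rightarrow> 'a \<Rightarrow> real" where
  "acoef g c p \<epsilon> u i j x =
     ginv g c x $ i $ j + (p - 2) * (grad g c u x $ i * grad g c u x $ j / sigma_reg g c \<epsilon> u x)"

text \<open>\<open>Lop g c p \<epsilon> u \<phi>\<close> is \<open>L\<^sub>\<epsilon> \<phi>\<close>, with the coefficients \<open>a\<^sub>\<epsilon>\<close> formed from the function \<open>u\<close>.\<close>

definition Lop ::
  "('a, 'n::finite) metric \<Rightarrow> ('a, 'n) chart \<Rightarrow> real \<Rightarrow> real \<Rightarrow> ('a \<Rightarrow> real) \<Rightarrow> ('a \<Rightarrow> real) \<Rightarrow> 'a \<Rightarrow> real" where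
  "Lop g c p \<epsilon> u \<phi> x = (\<Sum>i\<in>UNIV. \<Sum>j\<in>UNIV. acoef g c p \<epsilon> u i j x * hess g c i j \<phi> x)"

definition Qop ::
  "('a, 'n::finite) metric \<Rightarrow> ('a, 'n) chart \<Rightarrow> real \<Rightarrow> real \<Rightarrow> ('a \<Rightarrow> real) \<Rightarrow> 'a \<Rightarrow> real" where
  "Qop g c p \<epsilon> u x =
     (\<Sum>i\<in>UNIV. \<Sum>j\<in>UNIV. \<Sum>k\<in>UNIV. \<Sum>l\<in>UNIV.
        acoef g c p \<epsilon> u i j x * ginv g c x $ k $ l * hess g c k i u x * hess g c l j u x)"

definition Bfield ::
  "('a, 'n::finite) metric \<Rightarrow> ('a, 'n) chart \<Rightarrow> real \<Rightarrow> ('a \<Rightarrow> real) \<Rightarrow> 'a \<Rightarrow> real^'n" where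
  "Bfield g c \<epsilon> u x =
     (1 / sigma_reg g c \<epsilon> u x) *\<^sub>R hess_end g c u x (grad g c u x)
     - (hess_bil g c u x (grad g c u x) (grad g c u x) / (sigma_reg g c \<epsilon> u x)\<^sup>2) *\<^sub>R grad g c u x"

text \<open>Derivative of a function on \<open>[0,\<infinity>)\<close>, one-sided at \<open>0\<close>.\<close>

definition hderiv :: "(real \<Rightarrow> real) \<Rightarrow> real \<Rightarrow> real" where
  "hderiv h r = vector_derivative h (at r within {0..})"

definition Afield ::
  "('a, 'n::finite) metric \<Rightarrow> ('a, 'n) chart \<Rightarrow> real \<Rightarrow> real \<Rightarrow> (real \<Rightarrow> real) \<Rightarrow> ('a \<Rightarrow> real) \<Rightarrow> 'a \<Rightarrow> real^'n" where
  "Afield g c p \<epsilon> h u x =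
     hderiv h (sfun g c u x) *\<^sub>R grad g c u x + (p - 2) *\<^sub>R Bfield g c \<epsilon> u x"

text \<open>Functions on \<open>M \<times> (0,T]\<close> are written \<open>v t x\<close>; the time derivative is one-sided at \<open>t = T\<close>.\<close>

definition tderiv :: "real \<Rightarrow> (real \<Rightarrow> 'a \<Rightarrow> real) \<Rightarrow> real \<Rightarrow> 'a \<Rightarrow> real" where
  "tderiv T v t x = vector_derivative (\<lambda>\<tau>. v \<tau> x) (at t within {0<..T})"

definition wfun ::
  "('a, 'n::finite) metric \<Rightarrow> ('a, 'n) chart \<Rightarrow> real \<Rightarrow> real \<Rightarrow> (real \<Rightarrow> 'a \<Rightarrow> real) \<Rightarrow> real \<Rightarrow> 'a \<Rightarrow> real" where
  "wfun g c p \<epsilon> v t x = - Lop g c p \<epsilon> (v t) (v t) x"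

end

theory Submission
  imports Defs
begin

text \<open>
  Fix a chart. Write \<open>\<Delta>\<phi> = g\<^sup>i\<^sup>j \<nabla>\<^sub>i\<^sub>j\<phi>\<close>, \<open>N\<phi> = \<nabla>\<^sup>2\<phi>(\<nabla>v,\<nabla>v)\<close> and \<open>P = Nv\<close>, so that \<open>L\<^sub>\<epsilon>\<phi> = \<Delta>\<phi> + (p-2) N\<phi> / \<sigma>\<close>.

  The idea is to compare \<open>w\<close> with \<open>v\<^sub>t\<close>. By definition \<open>w = - L\<^sub>\<epsilon> v\<close>, and since the metric is independent of
  time, \<open>w\<^sub>t = - L\<^sub>\<epsilon> v\<^sub>t - (a\<^sup>i\<^sup>j)\<^sub>t \<nabla>\<^sub>i\<^sub>jv\<close>. The equation says \<open>v\<^sub>t + w = h(s)\<close>. Therefore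
  \<open>L\<^sub>\<epsilon> w - w\<^sub>t = L\<^sub>\<epsilon> (h(s)) + (a\<^sup>i\<^sup>j)\<^sub>t \<nabla>\<^sub>i\<^sub>jv\<close>, and the last term is \<open>2 (p-2) \<langle>B, \<nabla>v\<^sub>t\<rangle>\<close>.
  The chain rule gives \<open>L\<^sub>\<epsilon> (h(s)) = h'(s) L\<^sub>\<epsilon> s + h''(s) a\<^sup>i\<^sup>j s\<^sub>i s\<^sub>j\<close>, so it remains to compute \<open>L\<^sub>\<epsilon> s\<close>.

  For the Laplacian part this is the Bochner formula (\<open>bochner\<close>),
  \<open>\<Delta>s = 2 |\<nabla>\<^sup>2v|\<^sup>2 + 2 \<langle>\<nabla>v, \<nabla>\<Delta>v\<rangle> + 2 Ric(\<nabla>v,\<nabla>v)\<close>, proved from the contracted Ricci identity for the vector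
  field \<open>\<nabla>v\<close>. For the other part, differentiating \<open>P = \<langle>\<nabla>v, \<nabla>s\<rangle> / 2\<close> along \<open>\<nabla>v\<close> gives
  \<open>N s = 2 \<langle>\<nabla>v, \<nabla>P\<rangle> - |\<nabla>s|\<^sup>2 / 2\<close> (\<open>he_grad_grad_sq\<close>). In the sum, the gradients of \<open>\<Delta>v\<close> and \<open>P\<close> combine to
  \<open>\<nabla>w\<close>, and \<open>L\<^sub>\<epsilon> s = 2 Q + 2 Ric(\<nabla>v,\<nabla>v) - 2 \<langle>\<nabla>v, \<nabla>w\<rangle> - 2 (p-2) \<langle>B, \<nabla>s\<rangle>\<close>. Inserting
  \<open>\<nabla>v\<^sub>t = h'(s) \<nabla>s - \<nabla>w\<close> cancels the terms \<open>\<langle>B, \<nabla>s\<rangle>\<close> and leaves the drift \<open>A\<close>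
  (\<open>evolution_identity\<close>).

  This computation is done for smooth functions on an open subset of space-time. To reach all of
  \<open>M \<times> (0,T]\<close>, the solution is replaced near a point by a smooth extension, and \<open>h\<close> near \<open>s\<close> by one across
  \<open>0\<close> (\<open>chart_patch\<close>). The extension need not solve the equation after time \<open>T\<close>; this does no harm, since
  the equation is only differentiated in space, that is, within a time slice.
\<close>

section \<open>Calculus of smooth functions\<close>

abbreviation D :: "'a::euclidean_space \<Rightarrow> ('a \<Rightarrow> 'b::real_normed_vector) \<Rightarrow> 'a \<Rightarrow> 'b" where
  "D b f z \<equiv> frechet_derivative f (at z) b"

definition Cinf_on :: "'a::euclidean_space set \<Rightarrow> ('a \<Rightarrow> 'b::real_normed_vector) \<Rightarrow> bool" where
  "Cinf_on W f \<longleftrightarrow> (\<forall>k. Ck_on k W f)"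

lemma Ck_on_SucD: "Ck_on (Suc k) W f \<Longrightarrow> Ck_on k W f"
proof (induction k arbitrary: f)
  case 0
  then show ?case
    by (auto intro!: differentiable_imp_continuous_on simp: differentiable_on_def
        differentiable_at_withinI)
next
  case (Suc k)
  then show ?case by auto
qed

lemma Ck_on_cong:
  assumes "open W" "\<And>x. x \<in> W \<Longrightarrow> f x = g x" "Ck_on k W f"
  shows "Ck_on k W g"
  using assms(2,3)
proof (induction k arbitrary: f g)
  case 0
  then show ?case by (simp cong: continuous_on_cong)
next
  case (Suc k)
  have d: "f differentiable (at x)" if "x \<in> W" for x
    using Suc.prems that by simp
  have *: "g differentiable (at x)" "frechet_derivative f (at x) = frechet_derivative g (at x)"
    if "x \<in> W" for x
    using d[OF that] has_derivative_transform_within_open[of f _ x UNIV W g] that assms(1) Suc.prems(1)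
      frechet_derivative_transform_within_open[of f x W g]
    by (auto simp: differentiable_def)
  show ?case
    using Suc.IH[of "\<lambda>x. frechet_derivative f (at x) b" "\<lambda>x. frechet_derivative g (at x) b" for b]
      Suc.prems * by auto
qed

lemma D_eq: "(f has_derivative f') (at z) \<Longrightarrow> D b f z = f' b"
  using frechet_derivative_at by metis

text \<open>The recursion of \<open>Ck_on\<close> speaks of the chosen Frechet derivative; this introduction rule accepts any
  family of derivatives. The closure properties below, from sums to composition, are inductions on
  the order with this rule: each formula for a first derivative is again built from the operations in
  question.\<close>

lemma Ck_on_SucI:
  assumes "open W" "\<And>x. x \<in> W \<Longrightarrow> (f has_derivative (\<lambda>b. f' b x)) (at x)"
    and "\<And>b. b \<in> Basis \<Longrightarrow> Ck_on k W (f' b)"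
  shows "Ck_on (Suc k) W f"
proof -
  have "Ck_on k W (D b f)" if "b \<in> Basis" for b
    by (rule Ck_on_cong[OF assms(1) _ assms(3)[OF that]]) (simp add: D_eq[OF assms(2)])
  then show ?thesis using assms(2) by (auto simp: differentiable_def)
qed

lemma Ck_on_subset: "Ck_on k W f \<Longrightarrow> V \<subseteq> W \<Longrightarrow> Ck_on k V f"
  by (induction k arbitrary: f) (auto intro: continuous_on_subset)

lemma Cinf_on_subset: "Cinf_on W f \<Longrightarrow> V \<subseteq> W \<Longrightarrow> Cinf_on V f"
  by (auto simp: Cinf_on_def intro: Ck_on_subset)

lemma Cinf_on_cong:
  assumes "open W" "\<And>x. x \<in> W \<Longrightarrow> f x = g x" "Cinf_on W f"
  shows "Cinf_on W g"
  using assms Ck_on_cong[of W f g] by (auto simp: Cinf_on_def)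

lemma Cinf_on_differentiable: "Cinf_on W f \<Longrightarrow> z \<in> W \<Longrightarrow> f differentiable (at z)"
  unfolding Cinf_on_def by (metis Ck_on.simps(2))

lemma Cinf_on_continuous: "Cinf_on W f \<Longrightarrow> continuous_on W f"
  unfolding Cinf_on_def by (metis Ck_on.simps(1))

lemma Cinf_on_D: "Cinf_on W f \<Longrightarrow> b \<in> Basis \<Longrightarrow> Cinf_on W (D b f)"
  unfolding Cinf_on_def by (metis Ck_on.simps(2))

lemma D_cong:
  assumes "open W" "z \<in> W" "\<And>x. x \<in> W \<Longrightarrow> f x = g x" "f differentiable (at z)"
  shows "D b f z = D b g z"
  using frechet_derivative_transform_within_open[OF assms(4,1,2,3)] by simp

lemma Ck_on_const [simp]: "Ck_on k W (\<lambda>z. c)"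
  by (induction k arbitrary: c) auto

lemma Ck_on_add:
  assumes "open W" "Ck_on k W f" "Ck_on k W g"
  shows "Ck_on k W (\<lambda>z. f z + g z)"
  using assms(2,3)
proof (induction k arbitrary: f g)
  case 0
  then show ?case by (simp add: continuous_on_add)
next
  case (Suc k)
  show ?case
    using Suc by (intro Ck_on_SucI[OF assms(1), where f'="\<lambda>b x. D b f x + D b g x"])
      (auto intro!: has_derivative_add simp: frechet_derivative_works)
qed

lemma Ck_on_bounded_linear:
  assumes "open W" "bounded_linear L" "Ck_on k W f"
  shows "Ck_on k W (\<lambda>z. L (f z))"
  using assms(3)
proof (induction k arbitrary: f)
  case 0
  then show ?case
    using assms(2) by (simp add: linear_continuous_on continuous_on_compose2 bounded_linear.continuous_on)
next
  case (Suc k)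
  have 1: "((\<lambda>z. L (f z)) has_derivative (\<lambda>b. L (D b f x))) (at x)" if "x \<in> W" for x
    using Suc.prems that
    by (intro bounded_linear.has_derivative[OF assms(2)]) (auto simp: frechet_derivative_works)
  then show ?case
    using Suc by (intro Ck_on_SucI[OF assms(1), where f'="\<lambda>b x. L (D b f x)"]) auto
qed

lemma Ck_on_mult:
  fixes f g :: "_ \<Rightarrow> real"
  assumes "open W" "Ck_on k W f" "Ck_on k W g"
  shows "Ck_on k W (\<lambda>z. f z * g z)"
  using assms(2,3)
proof (induction k arbitrary: f g)
  case 0
  then show ?case by (simp add: continuous_on_mult)
next
  case (Suc k)
  have 1: "((\<lambda>z. f z * g z) has_derivative (\<lambda>b. f x * D b g x + D b f x * g x)) (at x)" if "x \<in> W" for x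
    using Suc.prems that
    by (intro has_derivative_mult) (auto simp: frechet_derivative_works)
  have "Ck_on k W (\<lambda>x. f x * D b g x + D b f x * g x)" if "b \<in> Basis" for b
    using that Suc.prems Suc.prems[THEN Ck_on_SucD] by (intro Ck_on_add[OF assms(1)] Suc.IH) auto
  then show ?case
    using 1 by (intro Ck_on_SucI[OF assms(1), where f'="\<lambda>b x. f x * D b g x + D b f x * g x"])
qed

lemma Ck_on_inverse:
  fixes f :: "_ \<Rightarrow> real"
  assumes "open W" "Ck_on k W f" "\<And>z. z \<in> W \<Longrightarrow> f z \<noteq> 0"
  shows "Ck_on k W (\<lambda>z. inverse (f z))"
  using assms(2)
proof (induction k)
  case 0
  then show ?case using assms(3) by (simp add: continuous_on_inverse)
next
  case (Suc k)
  have 1: "((\<lambda>z. inverse (f z)) has_derivative (\<lambda>b. - (inverse (f x) * D b f x * inverse (f x)))) (at x)"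
    if "x \<in> W" for x
    using Suc.prems that assms(3)
    by (intro Deriv.has_derivative_inverse) (auto simp: frechet_derivative_works)
  have "Ck_on k W (\<lambda>x. (-1) * (inverse (f x) * D b f x * inverse (f x)))" if "b \<in> Basis" for b
    using that Suc.prems Suc.IH[OF Suc.prems[THEN Ck_on_SucD]]
    by (intro Ck_on_mult[OF assms(1)] Ck_on_const) auto
  then show ?case
    using 1 by (intro Ck_on_SucI[OF assms(1),
          where f'="\<lambda>b x. (-1) * (inverse (f x) * D b f x * inverse (f x))"]) simp_all
qed

lemma has_derivative_comp_real:
  fixes h :: "real \<Rightarrow> real" and f :: "'a::euclidean_space \<Rightarrow> real"
  assumes "h differentiable (at (f x))" "f differentiable (at x)"
  shows "((\<lambda>z. h (f z)) has_derivative (\<lambda>b. D 1 h (f x) * D b f x)) (at x)"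
proof -
  have "((\<lambda>z. h (f z)) has_derivative (\<lambda>b. D (D b f x) h (f x))) (at x)"
    using has_derivative_compose[OF assms(2,1)[unfolded frechet_derivative_works]] .
  moreover have "D (D b f x) h (f x) = D 1 h (f x) * D b f x" for b
    using linear_cmul[OF linear_frechet_derivative[OF assms(1)], of "D b f x" 1] by (simp add: mult.commute)
  ultimately show ?thesis by (simp only:)
qed

lemma Ck_on_comp_real:
  fixes h :: "real \<Rightarrow> real" and f :: "'a::euclidean_space \<Rightarrow> real"
  assumes "open W" "Ck_on k J h" "Ck_on k W f" "\<And>z. z \<in> W \<Longrightarrow> f z \<in> J"
  shows "Ck_on k W (\<lambda>z. h (f z))"
  using assms(2,3)
proof (induction k arbitrary: h)
  case 0
  then show ?case using assms(4) continuous_on_compose2[of J h W f] by auto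
next
  case (Suc k)
  have 1: "((\<lambda>z. h (f z)) has_derivative (\<lambda>b. D 1 h (f x) * D b f x)) (at x)" if "x \<in> W" for x
    using Suc.prems that assms(4) by (intro has_derivative_comp_real[of h f]) auto
  have 2: "Ck_on k W (\<lambda>x. D 1 h (f x))"
    by (rule Suc.IH[of "D 1 h"]) (use Suc.prems Ck_on_SucD in simp_all)
  have "Ck_on k W (\<lambda>x. D 1 h (f x) * D b f x)" if "b \<in> Basis" for b
    by (rule Ck_on_mult[OF assms(1) 2]) (use Suc.prems that in simp)
  then show ?case
    using 1 by (intro Ck_on_SucI[OF assms(1), where f'="\<lambda>b x. D 1 h (f x) * D b f x"])
qed

lemma Cinf_on_const [simp]: "Cinf_on W (\<lambda>z. c)"
  by (simp add: Cinf_on_def)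

lemma Cinf_on_add: "open W \<Longrightarrow> Cinf_on W f \<Longrightarrow> Cinf_on W g \<Longrightarrow> Cinf_on W (\<lambda>z. f z + g z)"
  by (simp add: Cinf_on_def Ck_on_add)

lemma Cinf_on_bounded_linear:
  "open W \<Longrightarrow> bounded_linear L \<Longrightarrow> Cinf_on W f \<Longrightarrow> Cinf_on W (\<lambda>z. L (f z))"
  by (simp add: Cinf_on_def Ck_on_bounded_linear)

lemma Cinf_on_mult:
  fixes f g :: "_ \<Rightarrow> real"
  shows "open W \<Longrightarrow> Cinf_on W f \<Longrightarrow> Cinf_on W g \<Longrightarrow> Cinf_on W (\<lambda>z. f z * g z)"
  by (simp add: Cinf_on_def Ck_on_mult)

lemma Cinf_on_divide:
  fixes f g :: "_ \<Rightarrow> real"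
  assumes "open W" "Cinf_on W f" "Cinf_on W g" "\<And>z. z \<in> W \<Longrightarrow> g z \<noteq> 0"
  shows "Cinf_on W (\<lambda>z. f z / g z)"
  using assms by (simp add: Cinf_on_def Ck_on_mult Ck_on_inverse divide_inverse)

lemma Cinf_on_uminus:
  fixes f :: "_ \<Rightarrow> real"
  assumes "open W" "Cinf_on W f"
  shows "Cinf_on W (\<lambda>z. - f z)"
  using Cinf_on_mult[OF assms(1) Cinf_on_const[of W "-1"] assms(2)] by simp

lemma Cinf_on_diff:
  fixes f :: "_ \<Rightarrow> real"
  assumes "open W" "Cinf_on W f" "Cinf_on W g"
  shows "Cinf_on W (\<lambda>z. f z - g z)"
  using Cinf_on_add[OF assms(1,2) Cinf_on_uminus[OF assms(1,3)]] by simp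

lemma Cinf_on_power:
  fixes f :: "_ \<Rightarrow> real"
  assumes "open W" "Cinf_on W f"
  shows "Cinf_on W (\<lambda>z. f z ^ k)"
  using assms by (induction k) (simp_all add: Cinf_on_mult)

lemma Cinf_on_sum:
  assumes "open W" "\<And>i. i \<in> I \<Longrightarrow> Cinf_on W (f i)"
  shows "Cinf_on W (\<lambda>z. \<Sum>i\<in>I. f i z)"
  using assms by (induction I rule: infinite_finite_induct) (simp_all add: Cinf_on_add)

lemma Cinf_on_prod:
  fixes f :: "'i \<Rightarrow> _ \<Rightarrow> real"
  assumes "open W" "\<And>i. i \<in> I \<Longrightarrow> Cinf_on W (f i)"
  shows "Cinf_on W (\<lambda>z. \<Prod>i\<in>I. f i z)"
  using assms by (induction I rule: infinite_finite_induct) (simp_all add: Cinf_on_mult)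

lemma Cinf_on_comp_real:
  fixes h :: "real \<Rightarrow> real"
  assumes "open W" "Cinf_on J h" "Cinf_on W f" "\<And>z. z \<in> W \<Longrightarrow> f z \<in> J"
  shows "Cinf_on W (\<lambda>z. h (f z))"
  using assms Ck_on_comp_real[of W _ J h f] by (simp add: Cinf_on_def)

lemma Ck_on_fst:
  fixes f :: "'a::euclidean_space \<Rightarrow> 'b::real_normed_vector" and W :: "('a \<times> 'c::euclidean_space) set"
  assumes "open W" "Ck_on k V f" "fst ` W \<subseteq> V"
  shows "Ck_on k W (\<lambda>z. f (fst z))"
  using assms(2)
proof (induction k arbitrary: f)
  case 0
  then show ?case using assms(3) by (simp add: continuous_on_compose2[of V f W fst] continuous_on_fst)
next
  case (Suc k)
  have 1: "((\<lambda>z. f (fst z)) has_derivative (\<lambda>b. D (fst b) f (fst x))) (at x)" if "x \<in> W" for x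
  proof (rule has_derivative_compose[of fst fst])
    show "(fst has_derivative fst) (at x)"
      by (rule bounded_linear_imp_has_derivative[OF bounded_linear_fst])
    show "(f has_derivative frechet_derivative f (at (fst x))) (at (fst x))"
      using Suc.prems that assms(3) by (auto simp: frechet_derivative_works)
  qed
  have "Ck_on k W (\<lambda>x. D (fst b) f (fst x))" if "b \<in> Basis" for b
  proof (cases "fst b = 0")
    case True
    have "D (fst b) f (fst x) = 0" if "x \<in> W" for x
      unfolding True using Suc.prems that assms(3)
      by (intro linear_0 linear_frechet_derivative) auto
    then show ?thesis by (intro Ck_on_cong[OF assms(1) _ Ck_on_const[of k W 0]]) simp
  next
    case False
    then have "fst b \<in> Basis" using that by (auto simp: Basis_prod_def)
    then show ?thesis using Suc.prems by (intro Suc.IH[of "D (fst b) f"]) simp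
  qed
  then show ?case
    using 1 by (intro Ck_on_SucI[OF assms(1), where f'="\<lambda>b x. D (fst b) f (fst x)"])
qed

lemma Cinf_on_fst:
  assumes "open W" "Cinf_on V f" "fst ` W \<subseteq> V"
  shows "Cinf_on W (\<lambda>z. f (fst z))"
  using assms Ck_on_fst[of W _ V f] by (simp add: Cinf_on_def)

lemma D_add:
  assumes "f differentiable (at z)" "g differentiable (at z)"
  shows "D b (\<lambda>z. f z + g z) z = D b f z + D b g z"
  using D_eq[OF has_derivative_add[OF assms[unfolded frechet_derivative_works]]] .

lemma D_diff:
  assumes "f differentiable (at z)" "g differentiable (at z)"
  shows "D b (\<lambda>z. f z - g z) z = D b f z - D b g z"
  using D_eq[OF has_derivative_diff[OF assms[unfolded frechet_derivative_works]]] .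

lemma D_uminus:
  assumes "f differentiable (at z)"
  shows "D b (\<lambda>z. - f z) z = - D b f z"
  using D_eq[OF has_derivative_minus[OF assms[unfolded frechet_derivative_works]]] .

lemma D_mult:
  fixes f g :: "_ \<Rightarrow> real"
  assumes "f differentiable (at z)" "g differentiable (at z)"
  shows "D b (\<lambda>z. f z * g z) z = D b f z * g z + f z * D b g z"
  using D_eq[OF has_derivative_mult[OF assms[unfolded frechet_derivative_works]]] by simp

lemma D_divide:
  fixes f g :: "_ \<Rightarrow> real"
  assumes "f differentiable (at z)" "g differentiable (at z)" "g z \<noteq> 0"
  shows "D b (\<lambda>z. f z / g z) z = D b f z / g z - f z * D b g z / (g z)\<^sup>2"
  using D_eq[OF has_derivative_divide[OF assms(1,2)[unfolded frechet_derivative_works] assms(3)]] assms(3)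
  by (simp add: field_simps power2_eq_square)

lemma D_sum:
  assumes "\<And>i. i \<in> I \<Longrightarrow> f i differentiable (at z)"
  shows "D b (\<lambda>z. \<Sum>i\<in>I. f i z) z = (\<Sum>i\<in>I. D b (f i) z)"
  using D_eq[OF has_derivative_sum[of I f "\<lambda>i. frechet_derivative (f i) (at z)"]] assms
  by (simp add: frechet_derivative_works)

lemma D_comp_real:
  fixes h f :: "_ \<Rightarrow> real"
  assumes "h differentiable (at (f z))" "f differentiable (at z)"
  shows "D b (\<lambda>z. h (f z)) z = D 1 h (f z) * D b f z"
  using D_eq[OF has_derivative_comp_real[of h f, OF assms]] .

lemma has_real_derivative_along_line:
  fixes f :: "'a::euclidean_space \<Rightarrow> real"
  assumes "f differentiable (at (p + s *\<^sub>R a))"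
  shows "((\<lambda>s. f (p + s *\<^sub>R a)) has_real_derivative D a f (p + s *\<^sub>R a)) (at s)"
proof -
  have "((\<lambda>s. p + s *\<^sub>R a) has_derivative (\<lambda>r. r *\<^sub>R a)) (at s)"
    by (auto intro!: derivative_eq_intros)
  from has_derivative_compose[OF this assms[unfolded frechet_derivative_works]]
  have "((\<lambda>s. f (p + s *\<^sub>R a)) has_derivative (\<lambda>r. D (r *\<^sub>R a) f (p + s *\<^sub>R a))) (at s)" .
  moreover have "(\<lambda>r. D (r *\<^sub>R a) f (p + s *\<^sub>R a)) = (*) (D a f (p + s *\<^sub>R a))"
    by (rule ext) (simp add: linear_cmul[OF linear_frechet_derivative[OF assms]])
  ultimately show ?thesis by (simp add: has_field_derivative_def)
qed

text \<open>A directional derivative sees only the values on a line. This is what allows an equation that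
  holds at a single time to be differentiated in space.\<close>

lemma D_eq_of_eq_on_line:
  fixes f g :: "'e::euclidean_space \<Rightarrow> real"
  assumes f: "f differentiable (at z)" and g: "g differentiable (at z)"
    and eq: "\<forall>\<^sub>F r in nhds 0. f (z + r *\<^sub>R b) = g (z + r *\<^sub>R b)"
  shows "D b f z = D b g z"
proof -
  have "((\<lambda>r. f (z + r *\<^sub>R b)) has_real_derivative D b f z) (at 0)"
    "((\<lambda>r. g (z + r *\<^sub>R b)) has_real_derivative D b g z) (at 0)"
    using has_real_derivative_along_line[of f z 0 b] has_real_derivative_along_line[of g z 0 b] f g
    by simp_all
  then show ?thesis
    using DERIV_cong_ev[OF refl eq refl] DERIV_unique by blast
qed

text \<open>The symmetric second difference equals a mixed derivative at a nearby point, by the mean value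
  theorem in one direction and then in the other. Its left-hand side is symmetric in \<open>a\<close> and \<open>b\<close>,
  so it equals both mixed derivatives, and continuity gives that they agree. The step \<open>d/4\<close> keeps the
  far corner of the square inside the ball.\<close>

lemma second_difference:
  fixes f :: "'a::euclidean_space \<Rightarrow> real"
  assumes f: "Cinf_on (ball z d) f" and a: "a \<in> Basis" and b: "b \<in> Basis" and d: "0 < d"
  shows "\<exists>p\<in>ball z d. f (z + (d/4) *\<^sub>R a + (d/4) *\<^sub>R b) - f (z + (d/4) *\<^sub>R a)
            - f (z + (d/4) *\<^sub>R b) + f z = (d/4)\<^sup>2 * D b (D a f) p"
proof -
  have in_ball: "z + s *\<^sub>R a + t *\<^sub>R b \<in> ball z d" if "0 \<le> s" "s \<le> d/4" "0 \<le> t" "t \<le> d/4" for s t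
  proof -
    have "norm (s *\<^sub>R a + t *\<^sub>R b) \<le> norm (s *\<^sub>R a) + norm (t *\<^sub>R b)" by (rule norm_triangle_ineq)
    also have "\<dots> = s + t" using that a b by simp
    finally have "norm (s *\<^sub>R a + t *\<^sub>R b) < d" using that d by linarith
    moreover have "dist z (z + s *\<^sub>R a + t *\<^sub>R b) = norm (s *\<^sub>R a + t *\<^sub>R b)"
      by (metis add.assoc add_diff_cancel_left' dist_commute dist_norm)
    ultimately show ?thesis by simp
  qed
  define \<phi> where "\<phi> s = f (z + (d/4) *\<^sub>R b + s *\<^sub>R a) - f (z + s *\<^sub>R a)" for s
  have "DERIV \<phi> s :> D a f (z + (d/4) *\<^sub>R b + s *\<^sub>R a) - D a f (z + s *\<^sub>R a)"
    if "0 \<le> s" "s \<le> d/4" for s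
    unfolding \<phi>_def using in_ball[of s "d/4"] in_ball[of s 0] that d
    by (intro DERIV_diff has_real_derivative_along_line[of f] Cinf_on_differentiable[OF f])
       (simp_all add: add_ac)
  from MVT2[of 0 "d/4" \<phi>, OF _ this] d obtain s where s: "0 < s" "s < d/4"
    and 1: "\<phi> (d/4) - \<phi> 0 = (d/4) * (D a f (z + (d/4) *\<^sub>R b + s *\<^sub>R a) - D a f (z + s *\<^sub>R a))"
    by auto
  have "DERIV (\<lambda>t. D a f (z + s *\<^sub>R a + t *\<^sub>R b)) t :> D b (D a f) (z + s *\<^sub>R a + t *\<^sub>R b)"
    if "0 \<le> t" "t \<le> d/4" for t
    using in_ball[of s t] s that d
    by (intro has_real_derivative_along_line[of "D a f"] Cinf_on_differentiable[OF Cinf_on_D[OF f a]]) simp_all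
  from MVT2[of 0 "d/4" "\<lambda>t. D a f (z + s *\<^sub>R a + t *\<^sub>R b)", OF _ this] d
  obtain t where t: "0 < t" "t < d/4"
    and 2: "D a f (z + s *\<^sub>R a + (d/4) *\<^sub>R b) - D a f (z + s *\<^sub>R a)
       = (d/4) * D b (D a f) (z + s *\<^sub>R a + t *\<^sub>R b)" by auto
  have swap: "z + (d/4) *\<^sub>R b + s *\<^sub>R a = z + s *\<^sub>R a + (d/4) *\<^sub>R b"
    by (simp add: add_ac)
  have "\<phi> (d/4) - \<phi> 0 = (d/4)\<^sup>2 * D b (D a f) (z + s *\<^sub>R a + t *\<^sub>R b)"
    unfolding 1 swap 2 power2_eq_square by (rule mult.assoc[symmetric])
  then show ?thesis
    using in_ball[of s t] s t unfolding \<phi>_def by (intro bexI[of _ "z + s *\<^sub>R a + t *\<^sub>R b"]) (auto simp: add_ac)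
qed

lemma D_commute:
  fixes f :: "'a::euclidean_space \<Rightarrow> real"
  assumes W: "open W" "z \<in> W" and f: "Cinf_on W f" and ab: "a \<in> Basis" "b \<in> Basis"
  shows "D a (D b f) z = D b (D a f) z"
proof (rule ccontr)
  assume ne: "D a (D b f) z \<noteq> D b (D a f) z"
  define e where "e = \<bar>D a (D b f) z - D b (D a f) z\<bar> / 2"
  have e: "0 < e" using ne by (simp add: e_def)
  have cont: "isCont (D a (D b f)) z" "isCont (D b (D a f)) z"
    using W Cinf_on_continuous[OF Cinf_on_D[OF Cinf_on_D[OF f ab(2)] ab(1)]]
      Cinf_on_continuous[OF Cinf_on_D[OF Cinf_on_D[OF f ab(1)] ab(2)]]
    by (simp_all add: continuous_on_eq_continuous_at)
  obtain d1 where d1: "0 < d1" "\<And>p. dist p z < d1 \<Longrightarrow> dist (D a (D b f) p) (D a (D b f) z) < e"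
    using cont(1) e unfolding continuous_at_eps_delta by blast
  obtain d2 where d2: "0 < d2" "\<And>p. dist p z < d2 \<Longrightarrow> dist (D b (D a f) p) (D b (D a f) z) < e"
    using cont(2) e unfolding continuous_at_eps_delta by blast
  obtain d3 where d3: "0 < d3" "ball z d3 \<subseteq> W" using W openE by blast
  define d where "d = Min {d1, d2, d3}"
  have d: "0 < d" "d \<le> d1" "d \<le> d2" "ball z d \<subseteq> W" using d1 d2 d3 by (auto simp: d_def)
  have fd: "Cinf_on (ball z d) f" using Cinf_on_subset[OF f d(4)] .
  obtain p q where pq: "p \<in> ball z d" "q \<in> ball z d"
    and "(d/4)\<^sup>2 * D b (D a f) p = (d/4)\<^sup>2 * D a (D b f) q"
    using second_difference[OF fd ab d(1)] second_difference[OF fd ab(2,1) d(1)]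
    by (auto simp: algebra_simps)
  then have "D b (D a f) p = D a (D b f) q" using d by simp
  then show False
    using d1(2)[of q] d2(2)[of p] pq d e_def by (auto simp: dist_commute dist_real_def abs_if split: if_splits)
qed

section \<open>Smooth dependence of the inverse matrix\<close>

lemma matrix_inv_inverse:
  fixes A :: "'a::field^'n^'n"
  assumes "invertible A"
  shows "matrix_inv A ** A = mat 1" "A ** matrix_inv A = mat 1"
  using someI_ex[OF assms[unfolded invertible_def]] unfolding matrix_inv_def by auto

lemma transpose_matrix_inv:
  fixes A :: "'a::field^'n^'n"
  assumes "invertible A" "transpose A = A"
  shows "transpose (matrix_inv A) = matrix_inv A"
proof -
  have "transpose (matrix_inv A) = transpose (matrix_inv A) ** (A ** matrix_inv A)"
    by (simp add: matrix_inv_inverse[OF assms(1)])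
  also have "\<dots> = transpose (A ** matrix_inv A) ** matrix_inv A"
    by (simp add: matrix_transpose_mul assms(2) matrix_mul_assoc)
  also have "\<dots> = matrix_inv A"
    by (simp only: matrix_inv_inverse[OF assms(1)] transpose_mat matrix_mul_lid)
  finally show ?thesis .
qed

text \<open>Cramer's rule displays the inverse as a rational function of the entries, hence as a smooth one.\<close>

lemma matrix_inv_cramer:
  fixes A :: "real^'n^'n"
  assumes "invertible A"
  shows "matrix_inv A $ i $ j = det (\<chi> a b. if b = i then axis j 1 $ a else A $ a $ b) / det A"
proof -
  have 1: "A *v (matrix_inv A *v axis j 1) = axis j 1"
    by (simp add: matrix_vector_mul_assoc matrix_inv_inverse[OF assms])
  have 2: "(matrix_inv A *v axis j 1) $ i = matrix_inv A $ i $ j"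
    by (simp add: matrix_vector_mult_basis column_def)
  have "det (\<chi> a b. if b = i then axis j 1 $ a else A $ a $ b) = matrix_inv A $ i $ j * det A"
    using cramer_lemma[of i A "matrix_inv A *v axis j 1"] unfolding 1 2 .
  then show ?thesis using assms by (simp add: invertible_det_nz)
qed

lemma Cinf_on_det:
  fixes A :: "'e::euclidean_space \<Rightarrow> real^'n^'n"
  assumes "open W" "\<And>i j. Cinf_on W (\<lambda>z. A z $ i $ j)"
  shows "Cinf_on W (\<lambda>z. det (A z))"
  unfolding det_def
  by (intro Cinf_on_sum[OF assms(1)] Cinf_on_mult[OF assms(1)] Cinf_on_const
      Cinf_on_prod[OF assms(1)] assms(2))

lemma Cinf_on_matrix_inv:
  fixes A :: "'e::euclidean_space \<Rightarrow> real^'n^'n"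
  assumes W: "open W" and A: "\<And>i j. Cinf_on W (\<lambda>z. A z $ i $ j)"
    and inv: "\<And>z. z \<in> W \<Longrightarrow> invertible (A z)"
  shows "Cinf_on W (\<lambda>z. matrix_inv (A z) $ i $ j)"
proof (rule Cinf_on_cong[OF W])
  show "Cinf_on W (\<lambda>z. det (\<chi> a b. if b = i then axis j 1 $ a else A z $ a $ b) / det (A z))"
  proof (rule Cinf_on_divide[OF W])
    show "Cinf_on W (\<lambda>z. det (\<chi> a b. if b = i then axis j 1 $ a else A z $ a $ b))"
    proof (rule Cinf_on_det[OF W])
      show "Cinf_on W (\<lambda>z. (\<chi> a b. if b = i then axis j 1 $ a else A z $ a $ b) $ a $ b)" for a b
        using A by (cases "b = i") simp_all
    qed
  qed (use inv Cinf_on_det[OF W A] in \<open>auto simp: invertible_det_nz\<close>)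
qed (simp add: matrix_inv_cramer inv)

section \<open>Levi-Civita calculus in coordinates\<close>

lemma inverse_matrix_cancel:
  fixes A B :: "'n::finite \<Rightarrow> 'n \<Rightarrow> real"
  assumes "\<And>i k. (\<Sum>j\<in>UNIV. A i j * B j k) = (if i = k then 1 else 0)"
  shows "(\<Sum>j\<in>UNIV. A i j * (\<Sum>k\<in>UNIV. B j k * X k)) = X i"
proof -
  have "(\<Sum>j\<in>UNIV. A i j * (\<Sum>k\<in>UNIV. B j k * X k))
      = (\<Sum>k\<in>UNIV. (\<Sum>j\<in>UNIV. A i j * B j k) * X k)"
    unfolding sum_distrib_left sum_distrib_right mult.assoc by (rule sum.swap)
  also have "\<dots> = X i"
    unfolding assms by (simp add: if_distrib[of "\<lambda>u. u * _"] cong: if_cong)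
  finally show ?thesis .
qed

lemma sum_rotate:
  "(\<Sum>i\<in>A. \<Sum>k\<in>B. \<Sum>j\<in>C. f i k j) = (\<Sum>j\<in>C. \<Sum>i\<in>A. \<Sum>k\<in>B. f i k j)"
  for f :: "_ \<Rightarrow> _ \<Rightarrow> _ \<Rightarrow> real"
proof -
  have "(\<Sum>i\<in>A. \<Sum>k\<in>B. \<Sum>j\<in>C. f i k j) = (\<Sum>i\<in>A. \<Sum>j\<in>C. \<Sum>k\<in>B. f i k j)"
    by (rule sum.cong[OF refl], rule sum.swap)
  also have "\<dots> = (\<Sum>j\<in>C. \<Sum>i\<in>A. \<Sum>k\<in>B. f i k j)" by (rule sum.swap)
  finally show ?thesis .
qed

text \<open>\<open>gl\<close> and \<open>gu\<close> are the components \<open>g\<^sub>i\<^sub>j\<close> and \<open>g\<^sup>i\<^sup>j\<close> (lower and upper indices) and \<open>e i\<close> is the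
  \<open>i\<close>-th coordinate direction. The ambient space is arbitrary and may have further directions
  (below: time), so that a metric on space can be used on an open subset of space-time.\<close>

locale metric_coords =
  fixes W :: "'e::euclidean_space set" and e :: "'n::finite \<Rightarrow> 'e"
    and gl gu :: "'n \<Rightarrow> 'n \<Rightarrow> 'e \<Rightarrow> real"
  assumes W: "open W" and e: "e i \<in> Basis"
    and gl: "Cinf_on W (gl i j)" and gu: "Cinf_on W (gu i j)"
    and gl_sym: "z \<in> W \<Longrightarrow> gl i j z = gl j i z"
    and gu_sym: "z \<in> W \<Longrightarrow> gu i j z = gu j i z"
    and gu_gl: "z \<in> W \<Longrightarrow> (\<Sum>j\<in>UNIV. gu i j z * gl j k z) = (if i = k then 1 else 0)"
begin

abbreviation d :: "'n \<Rightarrow> ('e \<Rightarrow> real) \<Rightarrow> 'e \<Rightarrow> real" where "d i \<equiv> D (e i)"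

definition \<Gamma> :: "'n \<Rightarrow> 'n \<Rightarrow> 'n \<Rightarrow> 'e \<Rightarrow> real" where
  "\<Gamma> k i j z = (1/2) * (\<Sum>l\<in>UNIV. gu k l z * (d i (gl j l) z + d j (gl i l) z - d l (gl i j) z))"

definition gr :: "('e \<Rightarrow> real) \<Rightarrow> 'n \<Rightarrow> 'e \<Rightarrow> real" where
  "gr f i z = (\<Sum>j\<in>UNIV. gu i j z * d j f z)"

definition he :: "('e \<Rightarrow> real) \<Rightarrow> 'n \<Rightarrow> 'n \<Rightarrow> 'e \<Rightarrow> real" where
  "he f i j z = d i (d j f) z - (\<Sum>k\<in>UNIV. \<Gamma> k i j z * d k f z)"

definition Lap :: "('e \<Rightarrow> real) \<Rightarrow> 'e \<Rightarrow> real" where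
  "Lap f z = (\<Sum>i\<in>UNIV. \<Sum>j\<in>UNIV. gu i j z * he f i j z)"

definition ric :: "'n \<Rightarrow> 'n \<Rightarrow> 'e \<Rightarrow> real" where
  "ric j k z = (\<Sum>i\<in>UNIV. d i (\<Gamma> i j k) z - d j (\<Gamma> i i k) z
     + (\<Sum>m\<in>UNIV. \<Gamma> i i m z * \<Gamma> m j k z - \<Gamma> i j m z * \<Gamma> m i k z))"

text \<open>The squared length \<open>|\<nabla>f|\<^sup>2\<close>, written \<open>g\<^sup>i\<^sup>j f\<^sub>i f\<^sub>j\<close> so that only the inverse metric has to be differentiated.\<close>

definition grad_sq :: "('e \<Rightarrow> real) \<Rightarrow> 'e \<Rightarrow> real" where
  "grad_sq f z = (\<Sum>i\<in>UNIV. d i f z * gr f i z)"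

lemmas cinf_simps [simp] =
  gl gu Cinf_on_add[OF W] Cinf_on_mult[OF W] Cinf_on_diff[OF W] Cinf_on_uminus[OF W]
  Cinf_on_sum[OF W] Cinf_on_D

lemma e_simp [simp]: "e i \<in> Basis" by (rule e)

lemma cinf_\<Gamma> [simp]: "Cinf_on W (\<Gamma> k i j)"
  unfolding \<Gamma>_def[abs_def] by (rule Cinf_on_mult[OF W]) simp_all

lemma cinf_gr [simp]: "Cinf_on W f \<Longrightarrow> Cinf_on W (gr f i)"
  unfolding gr_def[abs_def] by simp

lemma cinf_he [simp]: "Cinf_on W f \<Longrightarrow> Cinf_on W (he f i j)"
  unfolding he_def[abs_def] by simp

lemma cinf_Lap [simp]: "Cinf_on W f \<Longrightarrow> Cinf_on W (Lap f)"
  unfolding Lap_def[abs_def] by simp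

lemma cinf_grad_sq [simp]: "Cinf_on W f \<Longrightarrow> Cinf_on W (grad_sq f)"
  unfolding grad_sq_def[abs_def] by simp

lemma DW_add: "z \<in> W \<Longrightarrow> Cinf_on W f \<Longrightarrow> Cinf_on W f' \<Longrightarrow>
    D b (\<lambda>z. f z + f' z) z = D b f z + (D b f' z :: real)"
  by (intro D_add Cinf_on_differentiable)

lemma DW_diff: "z \<in> W \<Longrightarrow> Cinf_on W f \<Longrightarrow> Cinf_on W f' \<Longrightarrow>
    D b (\<lambda>z. f z - f' z) z = D b f z - (D b f' z :: real)"
  by (intro D_diff Cinf_on_differentiable)

lemma DW_uminus: "z \<in> W \<Longrightarrow> Cinf_on W f \<Longrightarrow> D b (\<lambda>z. - f z) z = - (D b f z :: real)"
  by (intro D_uminus Cinf_on_differentiable)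

lemma DW_mult: "z \<in> W \<Longrightarrow> Cinf_on W f \<Longrightarrow> Cinf_on W f' \<Longrightarrow>
    D b (\<lambda>z. f z * f' z) z = D b f z * f' z + f z * (D b f' z :: real)"
  by (intro D_mult Cinf_on_differentiable)

lemma DW_sum: "z \<in> W \<Longrightarrow> (\<And>i. i \<in> I \<Longrightarrow> Cinf_on W (f i)) \<Longrightarrow>
    D b (\<lambda>z. \<Sum>i\<in>I. f i z) z = (\<Sum>i\<in>I. D b (f i) z :: real)"
  by (intro D_sum Cinf_on_differentiable)

lemmas DW = DW_add DW_diff DW_uminus DW_mult DW_sum

lemma DW_cong: "z \<in> W \<Longrightarrow> Cinf_on W f \<Longrightarrow> (\<And>x. x \<in> W \<Longrightarrow> f x = f' x) \<Longrightarrow> D b f z = D b f' z"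
  by (rule D_cong[OF W]) (auto intro: Cinf_on_differentiable)

lemma d_commute: "z \<in> W \<Longrightarrow> Cinf_on W f \<Longrightarrow> b \<in> Basis \<Longrightarrow> c \<in> Basis \<Longrightarrow>
    D b (D c f) z = (D c (D b f) z :: real)"
  by (rule D_commute[OF W])

lemma \<Gamma>_sym: "z \<in> W \<Longrightarrow> \<Gamma> k i j z = \<Gamma> k j i z"
proof -
  assume z: "z \<in> W"
  have "d l (gl i j) z = d l (gl j i) z" for l
    by (rule DW_cong[OF z gl gl_sym])
  then show ?thesis by (simp add: \<Gamma>_def add.commute)
qed

lemma he_sym: "z \<in> W \<Longrightarrow> Cinf_on W f \<Longrightarrow> he f i j z = he f j i z"
  unfolding he_def by (simp add: d_commute[of z f "e i" "e j"] \<Gamma>_sym[of z _ i j])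

lemma gl_gu: "z \<in> W \<Longrightarrow> (\<Sum>j\<in>UNIV. gl i j z * gu j k z) = (if i = k then 1 else 0)"
  using gu_gl[of z k i] by (simp add: gl_sym[of z i] gu_sym[of z _ k] mult.commute eq_commute cong: if_cong)

lemma gl_gu_cancel: "z \<in> W \<Longrightarrow> (\<Sum>j\<in>UNIV. gl i j z * (\<Sum>k\<in>UNIV. gu j k z * X k)) = X i"
  by (rule inverse_matrix_cancel) (rule gl_gu)

lemma gu_gl_cancel: "z \<in> W \<Longrightarrow> (\<Sum>j\<in>UNIV. gu i j z * (\<Sum>k\<in>UNIV. gl j k z * X k)) = X i"
  by (rule inverse_matrix_cancel) (rule gu_gl)

text \<open>Metric compatibility: \<open>\<nabla>g = 0\<close>.\<close>

lemma d_gl: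
  assumes z: "z \<in> W"
  shows "d m (gl i j) z = (\<Sum>l\<in>UNIV. gl i l z * \<Gamma> l m j z) + (\<Sum>l\<in>UNIV. gl j l z * \<Gamma> l m i z)"
proof -
  have lower: "(\<Sum>l\<in>UNIV. gl i l z * \<Gamma> l m j z)
      = (1/2) * (d m (gl j i) z + d j (gl m i) z - d i (gl m j) z)" for i j
    unfolding \<Gamma>_def mult.left_commute[of _ "1/2"] sum_distrib_left[symmetric]
    by (simp only: gl_gu_cancel[OF z])
  have "d m (gl i j) z = d m (gl j i) z" by (rule DW_cong[OF z gl gl_sym])
  then show ?thesis unfolding lower by (simp add: field_simps)
qed

text \<open>\<open>\<nabla>g\<^sup>i\<^sup>j = 0\<close>: differentiate \<open>g\<^sup>i\<^sup>j g\<^sub>j\<^sub>k = \<delta>\<^sup>i\<^sub>k\<close>, insert the compatibility of \<open>g\<close> and solve.\<close>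

lemma d_gu:
  assumes z: "z \<in> W"
  shows "d m (gu i l) z = - (\<Sum>q\<in>UNIV. gu i q z * \<Gamma> l m q z) - (\<Sum>q\<in>UNIV. \<Gamma> i m q z * gu q l z)"
proof -
  have *: "(\<Sum>j\<in>UNIV. gl k j z * (d m (gu i j) z + (\<Sum>q\<in>UNIV. gu i q z * \<Gamma> j m q z))) = - \<Gamma> i m k z" for k
  proof -
    have "0 = D (e m) (\<lambda>z. \<Sum>j\<in>UNIV. gu i j z * gl j k z) z"
      by (subst DW_cong[OF z, where f'="\<lambda>z. if i = k then 1 else 0"]) (simp_all add: gu_gl)
    also have "\<dots> = (\<Sum>j\<in>UNIV. d m (gu i j) z * gl j k z) + (\<Sum>j\<in>UNIV. gu i j z * d m (gl j k) z)"
      by (simp add: DW z sum.distrib)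
    also have "(\<Sum>j\<in>UNIV. gu i j z * d m (gl j k) z)
        = (\<Sum>j\<in>UNIV. gu i j z * (\<Sum>l\<in>UNIV. gl j l z * \<Gamma> l m k z))
          + (\<Sum>j\<in>UNIV. gu i j z * (\<Sum>l\<in>UNIV. gl k l z * \<Gamma> l m j z))"
      by (simp add: d_gl[OF z] distrib_left sum.distrib)
    also have "(\<Sum>j\<in>UNIV. gu i j z * (\<Sum>l\<in>UNIV. gl j l z * \<Gamma> l m k z)) = \<Gamma> i m k z"
      by (rule gu_gl_cancel[OF z])
    also have "(\<Sum>j\<in>UNIV. gu i j z * (\<Sum>l\<in>UNIV. gl k l z * \<Gamma> l m j z))
        = (\<Sum>l\<in>UNIV. gl k l z * (\<Sum>j\<in>UNIV. gu i j z * \<Gamma> l m j z))"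
      unfolding sum_distrib_left by (subst sum.swap) (simp add: mult.left_commute)
    finally show ?thesis
      by (simp add: distrib_left sum.distrib gl_sym[OF z, of k] mult.commute)
  qed
  have "d m (gu i l) z + (\<Sum>q\<in>UNIV. gu i q z * \<Gamma> l m q z)
      = (\<Sum>k\<in>UNIV. gu l k z * (\<Sum>j\<in>UNIV. gl k j z * (d m (gu i j) z + (\<Sum>q\<in>UNIV. gu i q z * \<Gamma> j m q z))))"
    using gu_gl_cancel[OF z] by simp
  also have "\<dots> = - (\<Sum>q\<in>UNIV. \<Gamma> i m q z * gu q l z)"
    unfolding * by (simp add: sum_negf gu_sym[OF z, of l] mult.commute)
  finally show ?thesis by simp
qed

text \<open>The covariant derivative of the gradient is the Hessian with one index raised, since raising an index
  commutes with covariant differentiation.\<close>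

lemma d_gr:
  assumes z: "z \<in> W" and f: "Cinf_on W f"
  shows "d m (gr f i) z = (\<Sum>j\<in>UNIV. gu i j z * he f m j z) - (\<Sum>k\<in>UNIV. \<Gamma> i m k z * gr f k z)"
proof -
  have "d m (gr f i) z = (\<Sum>j\<in>UNIV. d m (gu i j) z * d j f z) + (\<Sum>j\<in>UNIV. gu i j z * d m (d j f) z)"
    unfolding gr_def[abs_def] by (simp add: DW z f sum.distrib)
  also have "(\<Sum>j\<in>UNIV. d m (gu i j) z * d j f z)
      = - (\<Sum>j\<in>UNIV. \<Sum>q\<in>UNIV. gu i q z * \<Gamma> j m q z * d j f z)
        - (\<Sum>j\<in>UNIV. \<Sum>q\<in>UNIV. \<Gamma> i m q z * gu q j z * d j f z)"
    by (simp add: d_gu[OF z] left_diff_distrib sum_subtractf sum_negf sum_distrib_right)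
  also have "(\<Sum>j\<in>UNIV. \<Sum>q\<in>UNIV. \<Gamma> i m q z * gu q j z * d j f z) = (\<Sum>k\<in>UNIV. \<Gamma> i m k z * gr f k z)"
    unfolding gr_def sum_distrib_left by (subst sum.swap) (simp add: mult.assoc)
  also have "(\<Sum>j\<in>UNIV. gu i j z * d m (d j f) z) = (\<Sum>j\<in>UNIV. gu i j z * he f m j z)
      + (\<Sum>j\<in>UNIV. \<Sum>k\<in>UNIV. gu i j z * \<Gamma> k m j z * d k f z)"
    by (simp add: he_def right_diff_distrib sum_subtractf sum_distrib_left mult.assoc)
  also have "(\<Sum>j\<in>UNIV. \<Sum>k\<in>UNIV. gu i j z * \<Gamma> k m j z * d k f z)
      = (\<Sum>j\<in>UNIV. \<Sum>q\<in>UNIV. gu i q z * \<Gamma> j m q z * d j f z)"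
    by (rule sum.swap)
  finally show ?thesis by simp
qed

lemma Lap_eq_divergence:
  assumes z: "z \<in> W" and f: "Cinf_on W f"
  shows "Lap f z = (\<Sum>i\<in>UNIV. d i (gr f i) z) + (\<Sum>i\<in>UNIV. \<Sum>k\<in>UNIV. \<Gamma> i i k z * gr f k z)"
  by (simp add: Lap_def d_gr[OF z f] sum_subtractf)

lemma sum_d_gr:
  assumes z: "z \<in> W"
  shows "(\<Sum>i\<in>UNIV. gr f i z * d i f' z) = (\<Sum>i\<in>UNIV. d i f z * gr f' i z)"
proof -
  have "(\<Sum>i\<in>UNIV. gr f i z * d i f' z) = (\<Sum>i\<in>UNIV. \<Sum>j\<in>UNIV. gu i j z * d j f z * d i f' z)"
    by (simp add: gr_def sum_distrib_right)
  also have "\<dots> = (\<Sum>j\<in>UNIV. \<Sum>i\<in>UNIV. gu i j z * d j f z * d i f' z)" by (rule sum.swap)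
  also have "\<dots> = (\<Sum>i\<in>UNIV. d i f z * gr f' i z)"
    by (simp add: gr_def sum_distrib_left gu_sym[OF z] mult_ac cong: sum.cong)
  finally show ?thesis .
qed

lemma d_grad_sq:
  assumes z: "z \<in> W" and f: "Cinf_on W f"
  shows "d m (grad_sq f) z = 2 * (\<Sum>i\<in>UNIV. he f m i z * gr f i z)"
proof -
  have "d m (grad_sq f) z = (\<Sum>i\<in>UNIV. d m (d i f) z * gr f i z) + (\<Sum>i\<in>UNIV. d i f z * d m (gr f i) z)"
    unfolding grad_sq_def[abs_def] by (simp add: DW z f sum.distrib)
  also have "(\<Sum>i\<in>UNIV. d m (d i f) z * gr f i z) = (\<Sum>i\<in>UNIV. he f m i z * gr f i z)
      + (\<Sum>i\<in>UNIV. \<Sum>k\<in>UNIV. \<Gamma> k m i z * d k f z * gr f i z)"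
    by (simp add: he_def left_diff_distrib sum_subtractf sum_distrib_right)
  also have "(\<Sum>i\<in>UNIV. d i f z * d m (gr f i) z)
      = (\<Sum>i\<in>UNIV. \<Sum>j\<in>UNIV. d i f z * (gu i j z * he f m j z))
       - (\<Sum>i\<in>UNIV. \<Sum>k\<in>UNIV. d i f z * (\<Gamma> i m k z * gr f k z))"
    by (simp add: d_gr[OF z f] right_diff_distrib sum_subtractf sum_distrib_left)
  also have "(\<Sum>i\<in>UNIV. \<Sum>k\<in>UNIV. d i f z * (\<Gamma> i m k z * gr f k z))
      = (\<Sum>i\<in>UNIV. \<Sum>k\<in>UNIV. \<Gamma> k m i z * d k f z * gr f i z)"
    by (subst sum.swap) (simp add: mult_ac)
  also have "(\<Sum>i\<in>UNIV. \<Sum>j\<in>UNIV. d i f z * (gu i j z * he f m j z))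
      = (\<Sum>j\<in>UNIV. he f m j z * gr f j z)"
    unfolding gr_def sum_distrib_left by (subst sum.swap) (simp add: gu_sym[OF z] mult_ac cong: sum.cong)
  finally show ?thesis by simp
qed

section \<open>The Bochner formula\<close>

text \<open>The Hessian as an endomorphism, \<open>\<nabla>\<^sub>j \<nabla>\<^sup>i f\<close>.\<close>

definition hend :: "('e \<Rightarrow> real) \<Rightarrow> 'n \<Rightarrow> 'n \<Rightarrow> 'e \<Rightarrow> real" where
  "hend f i j z = (\<Sum>k\<in>UNIV. gu i k z * he f j k z)"

lemma cinf_hend [simp]: "Cinf_on W f \<Longrightarrow> Cinf_on W (hend f i j)"
  unfolding hend_def[abs_def] by simp

lemma d_gr_hend:
  assumes z: "z \<in> W" and f: "Cinf_on W f"
  shows "d j (gr f i) z = hend f i j z - (\<Sum>k\<in>UNIV. \<Gamma> i j k z * gr f k z)"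
  by (simp add: d_gr[OF z f] hend_def)

lemma gr_grad_sq:
  assumes z: "z \<in> W" and f: "Cinf_on W f"
  shows "gr (grad_sq f) i z = 2 * (\<Sum>j\<in>UNIV. hend f i j z * gr f j z)"
proof -
  have "gr (grad_sq f) i z = 2 * (\<Sum>m\<in>UNIV. \<Sum>j\<in>UNIV. gu i m z * he f m j z * gr f j z)"
    unfolding gr_def[of "grad_sq f"] by (simp add: d_grad_sq[OF z f] sum_distrib_left mult_ac)
  also have "(\<Sum>m\<in>UNIV. \<Sum>j\<in>UNIV. gu i m z * he f m j z * gr f j z)
      = (\<Sum>j\<in>UNIV. \<Sum>m\<in>UNIV. gu i m z * he f m j z * gr f j z)" by (rule sum.swap)
  also have "\<dots> = (\<Sum>j\<in>UNIV. hend f i j z * gr f j z)"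
    by (simp add: hend_def sum_distrib_right he_sym[OF z f])
  finally show ?thesis .
qed

lemma d_hend:
  assumes z: "z \<in> W" and f: "Cinf_on W f"
  shows "d m (hend f i j) z = d m (d j (gr f i)) z
      + (\<Sum>k\<in>UNIV. d m (\<Gamma> i j k) z * gr f k z) + (\<Sum>k\<in>UNIV. \<Gamma> i j k z * d m (gr f k) z)"
proof -
  have "d m (hend f i j) z = d m (\<lambda>z. d j (gr f i) z + (\<Sum>k\<in>UNIV. \<Gamma> i j k z * gr f k z)) z"
    by (rule DW_cong[OF z]) (simp_all add: f d_gr_hend)
  then show ?thesis by (simp add: DW z f sum.distrib)
qed

text \<open>The contracted Ricci identity \<open>\<nabla>\<^sub>i \<nabla>\<^sub>j G\<^sup>i - \<nabla>\<^sub>j \<nabla>\<^sub>i G\<^sup>i = Ric\<^sub>j\<^sub>k G\<^sup>k\<close> for the vector field \<open>G = \<nabla>f\<close>. In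
  coordinates it comes from commuting the second partial derivatives of the functions \<open>G\<^sup>i\<close>. Because the
  identity is traced on a vector field, the contraction of the curvature is the Ricci tensor as it stands.\<close>

lemma ricci_identity_traced:
  assumes z: "z \<in> W" and f: "Cinf_on W f"
  shows "(\<Sum>i\<in>UNIV. d i (hend f i j) z) - (\<Sum>i\<in>UNIV. d j (hend f i i) z)
      + (\<Sum>i\<in>UNIV. \<Sum>k\<in>UNIV. \<Gamma> i i k z * hend f k j z)
      - (\<Sum>i\<in>UNIV. \<Sum>k\<in>UNIV. hend f i k z * \<Gamma> k i j z)
    = (\<Sum>k\<in>UNIV. ric j k z * gr f k z)"
proof -
  let ?G = "\<lambda>k. gr f k z" and ?K = "\<lambda>i j. hend f i j z" and ?\<Gamma> = "\<lambda>i j k. \<Gamma> i j k z"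
  have "(\<Sum>i\<in>UNIV. d i (hend f i j) z) - (\<Sum>i\<in>UNIV. d j (hend f i i) z)
      = (\<Sum>i\<in>UNIV. \<Sum>k\<in>UNIV. (d i (\<Gamma> i j k) z - d j (\<Gamma> i i k) z) * ?G k)
        + (\<Sum>i\<in>UNIV. \<Sum>k\<in>UNIV. ?\<Gamma> i j k * d i (gr f k) z)
        - (\<Sum>i\<in>UNIV. \<Sum>k\<in>UNIV. ?\<Gamma> i i k * d j (gr f k) z)"
    by (simp add: d_hend[OF z f] d_commute[OF z cinf_gr[OF f], of "e j" "e _"] sum.distrib
        left_diff_distrib sum_subtractf)
  also have "(\<Sum>i\<in>UNIV. \<Sum>k\<in>UNIV. ?\<Gamma> i j k * d i (gr f k) z)
      = (\<Sum>i\<in>UNIV. \<Sum>k\<in>UNIV. ?\<Gamma> i j k * ?K k i)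
        - (\<Sum>i\<in>UNIV. \<Sum>k\<in>UNIV. \<Sum>l\<in>UNIV. ?\<Gamma> i j k * ?\<Gamma> k i l * ?G l)"
    by (simp add: d_gr_hend[OF z f] right_diff_distrib sum_subtractf sum_distrib_left mult.assoc)
  also have "(\<Sum>i\<in>UNIV. \<Sum>k\<in>UNIV. ?\<Gamma> i i k * d j (gr f k) z)
      = (\<Sum>i\<in>UNIV. \<Sum>k\<in>UNIV. ?\<Gamma> i i k * ?K k j)
        - (\<Sum>i\<in>UNIV. \<Sum>k\<in>UNIV. \<Sum>l\<in>UNIV. ?\<Gamma> i i k * ?\<Gamma> k j l * ?G l)"
    by (simp add: d_gr_hend[OF z f] right_diff_distrib sum_subtractf sum_distrib_left mult.assoc)
  also have "(\<Sum>i\<in>UNIV. \<Sum>k\<in>UNIV. ?\<Gamma> i j k * ?K k i)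
      = (\<Sum>i\<in>UNIV. \<Sum>k\<in>UNIV. ?K i k * ?\<Gamma> k i j)"
    by (subst sum.swap) (simp add: \<Gamma>_sym[OF z, of _ j] mult.commute)
  also have "(\<Sum>i\<in>UNIV. \<Sum>k\<in>UNIV. \<Sum>l\<in>UNIV. ?\<Gamma> i j k * ?\<Gamma> k i l * ?G l)
      = (\<Sum>l\<in>UNIV. \<Sum>i\<in>UNIV. \<Sum>k\<in>UNIV. ?\<Gamma> i j k * ?\<Gamma> k i l * ?G l)"
    by (rule sum_rotate)
  also have "(\<Sum>i\<in>UNIV. \<Sum>k\<in>UNIV. \<Sum>l\<in>UNIV. ?\<Gamma> i i k * ?\<Gamma> k j l * ?G l)
      = (\<Sum>l\<in>UNIV. \<Sum>i\<in>UNIV. \<Sum>k\<in>UNIV. ?\<Gamma> i i k * ?\<Gamma> k j l * ?G l)"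
    by (rule sum_rotate)
  also have "(\<Sum>i\<in>UNIV. \<Sum>k\<in>UNIV. (d i (\<Gamma> i j k) z - d j (\<Gamma> i i k) z) * ?G k)
      = (\<Sum>k\<in>UNIV. \<Sum>i\<in>UNIV. (d i (\<Gamma> i j k) z - d j (\<Gamma> i i k) z) * ?G k)"
    by (rule sum.swap)
  finally show ?thesis
    by (simp add: ric_def sum_distrib_right sum.distrib sum_subtractf left_diff_distrib distrib_right
        sum_distrib_left)
qed

lemma d_Lap:
  assumes z: "z \<in> W" and f: "Cinf_on W f"
  shows "d j (Lap f) z = (\<Sum>i\<in>UNIV. d j (hend f i i) z)"
proof -
  have "Lap f = (\<lambda>z. \<Sum>i\<in>UNIV. hend f i i z)" by (simp add: Lap_def hend_def fun_eq_iff)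
  then show ?thesis by (simp add: DW z f)
qed

text \<open>Since \<open>\<nabla>\<^sup>i s / 2 = (\<nabla>\<^sub>j G\<^sup>i) G\<^sup>j\<close> for \<open>s = |\<nabla>f|\<^sup>2\<close>, half the Laplacian of \<open>s\<close> is the divergence of that vector
  field. The product rule gives \<open>|\<nabla>\<^sup>2f|\<^sup>2\<close> and the term \<open>G\<^sup>j \<nabla>\<^sub>i \<nabla>\<^sub>j G\<^sup>i\<close>, where the Ricci identity moves the
  divergence past \<open>\<nabla>\<^sub>j\<close>.\<close>

lemma bochner:
  assumes z: "z \<in> W" and f: "Cinf_on W f"
  shows "Lap (grad_sq f) z = 2 * (\<Sum>i\<in>UNIV. \<Sum>j\<in>UNIV. hend f i j z * hend f j i z)
      + 2 * (\<Sum>j\<in>UNIV. gr f j z * d j (Lap f) z)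
      + 2 * (\<Sum>j\<in>UNIV. \<Sum>k\<in>UNIV. ric j k z * gr f j z * gr f k z)"
proof -
  let ?G = "\<lambda>k. gr f k z" and ?K = "\<lambda>i j. hend f i j z" and ?\<Gamma> = "\<lambda>i j k. \<Gamma> i j k z"
  have "d i (gr (grad_sq f) i) z = d i (\<lambda>z. 2 * (\<Sum>j\<in>UNIV. hend f i j z * gr f j z)) z" for i
    by (rule DW_cong[OF z]) (simp_all add: f gr_grad_sq)
  then have "d i (gr (grad_sq f) i) z
      = 2 * (\<Sum>j\<in>UNIV. d i (hend f i j) z * ?G j + ?K i j * d i (gr f j) z)" for i
    by (simp add: DW z f)
  then have "Lap (grad_sq f) z / 2
      = (\<Sum>i\<in>UNIV. \<Sum>j\<in>UNIV. d i (hend f i j) z * ?G j)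
        + (\<Sum>i\<in>UNIV. \<Sum>j\<in>UNIV. ?K i j * d i (gr f j) z)
        + (\<Sum>i\<in>UNIV. \<Sum>k\<in>UNIV. \<Sum>j\<in>UNIV. ?\<Gamma> i i k * ?K k j * ?G j)"
    by (simp add: Lap_eq_divergence[OF z cinf_grad_sq[OF f]] gr_grad_sq[OF z f] sum.distrib
        sum_distrib_left[symmetric] mult.left_commute[of _ 2] mult.assoc)
  also have "(\<Sum>i\<in>UNIV. \<Sum>j\<in>UNIV. ?K i j * d i (gr f j) z)
      = (\<Sum>i\<in>UNIV. \<Sum>j\<in>UNIV. ?K i j * ?K j i)
        - (\<Sum>i\<in>UNIV. \<Sum>k\<in>UNIV. \<Sum>j\<in>UNIV. ?K i k * ?\<Gamma> k i j * ?G j)"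
    by (simp add: d_gr_hend[OF z f] right_diff_distrib sum_subtractf sum_distrib_left mult.assoc)
  also have "(\<Sum>i\<in>UNIV. \<Sum>j\<in>UNIV. d i (hend f i j) z * ?G j)
      = (\<Sum>j\<in>UNIV. ?G j * (\<Sum>i\<in>UNIV. d i (hend f i j) z))"
    by (subst sum.swap) (simp add: sum_distrib_left mult.commute)
  also have "(\<Sum>i\<in>UNIV. \<Sum>k\<in>UNIV. \<Sum>j\<in>UNIV. ?\<Gamma> i i k * ?K k j * ?G j)
      = (\<Sum>j\<in>UNIV. ?G j * (\<Sum>i\<in>UNIV. \<Sum>k\<in>UNIV. ?\<Gamma> i i k * ?K k j))"
    by (rule trans[OF sum_rotate]) (simp add: sum_distrib_left mult_ac)
  also have "(\<Sum>i\<in>UNIV. \<Sum>k\<in>UNIV. \<Sum>j\<in>UNIV. ?K i k * ?\<Gamma> k i j * ?G j)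
      = (\<Sum>j\<in>UNIV. ?G j * (\<Sum>i\<in>UNIV. \<Sum>k\<in>UNIV. ?K i k * ?\<Gamma> k i j))"
    by (rule trans[OF sum_rotate]) (simp add: sum_distrib_left mult_ac)
  finally have "Lap (grad_sq f) z / 2 = (\<Sum>i\<in>UNIV. \<Sum>j\<in>UNIV. ?K i j * ?K j i)
      + (\<Sum>j\<in>UNIV. ?G j * ((\<Sum>i\<in>UNIV. d i (hend f i j) z)
      + (\<Sum>i\<in>UNIV. \<Sum>k\<in>UNIV. \<Gamma> i i k z * hend f k j z)
      - (\<Sum>i\<in>UNIV. \<Sum>k\<in>UNIV. hend f i k z * \<Gamma> k i j z)))"
    by (simp add: distrib_left right_diff_distrib sum.distrib sum_subtractf)
  moreover have "(\<Sum>i\<in>UNIV. d i (hend f i j) z)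
      + (\<Sum>i\<in>UNIV. \<Sum>k\<in>UNIV. \<Gamma> i i k z * hend f k j z)
      - (\<Sum>i\<in>UNIV. \<Sum>k\<in>UNIV. hend f i k z * \<Gamma> k i j z)
      = d j (Lap f) z + (\<Sum>k\<in>UNIV. ric j k z * ?G k)" for j
    using ricci_identity_traced[OF z f, of j] d_Lap[OF z f, of j] by linarith
  ultimately have "Lap (grad_sq f) z / 2 = (\<Sum>i\<in>UNIV. \<Sum>j\<in>UNIV. ?K i j * ?K j i)
      + (\<Sum>j\<in>UNIV. ?G j * (d j (Lap f) z + (\<Sum>k\<in>UNIV. ric j k z * ?G k)))"
    by (simp only:)
  also have "(\<Sum>j\<in>UNIV. ?G j * (d j (Lap f) z + (\<Sum>k\<in>UNIV. ric j k z * ?G k)))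
      = (\<Sum>j\<in>UNIV. ?G j * d j (Lap f) z)
        + (\<Sum>j\<in>UNIV. \<Sum>k\<in>UNIV. ric j k z * ?G j * ?G k)"
    by (simp add: distrib_left sum.distrib sum_distrib_left mult_ac)
  finally show ?thesis by simp
qed

text \<open>The Hessian of \<open>\<phi>\<close> evaluated twice on \<open>\<nabla>f\<close>; up to the factor \<open>(p - 2) / \<sigma>\<close> this is the
  rank-one part of the operator \<open>L\<^sub>\<epsilon>\<close>.\<close>

definition he_grad :: "('e \<Rightarrow> real) \<Rightarrow> ('e \<Rightarrow> real) \<Rightarrow> 'e \<Rightarrow> real" where
  "he_grad f \<phi> z = (\<Sum>i\<in>UNIV. \<Sum>j\<in>UNIV. gr f i z * gr f j z * he \<phi> i j z)"

lemma cinf_he_grad [simp]: "Cinf_on W f \<Longrightarrow> Cinf_on W \<phi> \<Longrightarrow> Cinf_on W (he_grad f \<phi>)"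
  unfolding he_grad_def[abs_def] by simp

lemma he_grad_self:
  assumes z: "z \<in> W" and f: "Cinf_on W f"
  shows "he_grad f f z = (1/2) * (\<Sum>m\<in>UNIV. gr f m z * d m (grad_sq f) z)"
  unfolding he_grad_def by (simp add: d_grad_sq[OF z f] sum_distrib_left mult_ac)

text \<open>The counterpart of the Bochner formula for the second part of \<open>L\<^sub>\<epsilon>\<close>. No curvature appears, because
  \<open>\<nabla>\<^sup>2f(\<nabla>f,\<nabla>f) = \<langle>\<nabla>f, \<nabla>s\<rangle> / 2\<close> is simply differentiated along \<open>\<nabla>f\<close>.\<close>

lemma he_grad_grad_sq:
  assumes z: "z \<in> W" and f: "Cinf_on W f"
  shows "he_grad f (grad_sq f) z = 2 * (\<Sum>k\<in>UNIV. gr f k z * d k (he_grad f f) z) - (1/2) * grad_sq (grad_sq f) z"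
proof -
  let ?G = "\<lambda>k. gr f k z" and ?s = "grad_sq f"
  have "d k (he_grad f f) z = d k (\<lambda>z. (1/2) * (\<Sum>m\<in>UNIV. gr f m z * d m ?s z)) z" for k
    by (rule DW_cong[OF z]) (simp_all add: f he_grad_self)
  also have "\<dots> k = (1/2) * ((\<Sum>m\<in>UNIV. d k (gr f m) z * d m ?s z) + (\<Sum>m\<in>UNIV. ?G m * d k (d m ?s) z))" for k
    by (subst DW_mult) (simp_all add: DW z f sum.distrib)
  finally have "2 * (\<Sum>k\<in>UNIV. ?G k * d k (he_grad f f) z)
      = (\<Sum>k\<in>UNIV. \<Sum>m\<in>UNIV. ?G k * d k (gr f m) z * d m ?s z)
        + (\<Sum>k\<in>UNIV. \<Sum>m\<in>UNIV. ?G k * ?G m * d k (d m ?s) z)"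
    by (simp add: distrib_left sum.distrib sum_distrib_left mult.assoc)
  also have "(\<Sum>k\<in>UNIV. \<Sum>m\<in>UNIV. ?G k * d k (gr f m) z * d m ?s z)
      = (\<Sum>k\<in>UNIV. \<Sum>m\<in>UNIV. hend f m k z * ?G k * d m ?s z)
       - (\<Sum>k\<in>UNIV. \<Sum>m\<in>UNIV. \<Sum>l\<in>UNIV. ?G k * ?G l * \<Gamma> m k l z * d m ?s z)"
    by (simp add: d_gr_hend[OF z f] right_diff_distrib left_diff_distrib sum_subtractf
        sum_distrib_left sum_distrib_right mult_ac)
  also have "(\<Sum>k\<in>UNIV. \<Sum>m\<in>UNIV. hend f m k z * ?G k * d m ?s z)
      = (\<Sum>m\<in>UNIV. (\<Sum>k\<in>UNIV. hend f m k z * ?G k) * d m ?s z)"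
    by (subst sum.swap) (simp add: sum_distrib_right)
  also have "\<dots> = (1/2) * grad_sq ?s z"
    unfolding grad_sq_def[of "grad_sq f"] by (simp add: gr_grad_sq[OF z f] sum_distrib_left mult_ac)
  also have "(\<Sum>k\<in>UNIV. \<Sum>m\<in>UNIV. \<Sum>l\<in>UNIV. ?G k * ?G l * \<Gamma> m k l z * d m ?s z)
      = (\<Sum>k\<in>UNIV. \<Sum>l\<in>UNIV. ?G k * ?G l * (\<Sum>m\<in>UNIV. \<Gamma> m k l z * d m ?s z))"
    by (rule sum.cong[OF refl], subst sum.swap) (simp add: sum_distrib_left mult.assoc)
  also have "(1/2) * grad_sq ?s z
        - (\<Sum>k\<in>UNIV. \<Sum>l\<in>UNIV. ?G k * ?G l * (\<Sum>m\<in>UNIV. \<Gamma> m k l z * d m ?s z))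
        + (\<Sum>k\<in>UNIV. \<Sum>m\<in>UNIV. ?G k * ?G m * d k (d m ?s) z)
      = (1/2) * grad_sq ?s z + he_grad f ?s z"
    unfolding he_grad_def he_def right_diff_distrib sum_subtractf by linarith
  finally show ?thesis by linarith
qed

lemma lower_gr: "z \<in> W \<Longrightarrow> (\<Sum>j\<in>UNIV. gl i j z * gr f j z) = d i f z"
  unfolding gr_def by (rule gl_gu_cancel)

lemma hess_contraction:
  assumes z: "z \<in> W" and f: "Cinf_on W f"
  shows "(\<Sum>i\<in>UNIV. \<Sum>j\<in>UNIV. \<Sum>k\<in>UNIV. \<Sum>l\<in>UNIV. gu i k z * gu j l z * he f i j z * he f k l z)
    = (\<Sum>i\<in>UNIV. \<Sum>j\<in>UNIV. hend f i j z * hend f j i z)"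
proof (rule sum.cong[OF refl])
  fix i
  have "(\<Sum>j\<in>UNIV. \<Sum>k\<in>UNIV. \<Sum>l\<in>UNIV. gu i k z * gu j l z * he f i j z * he f k l z)
    = (\<Sum>l\<in>UNIV. \<Sum>j\<in>UNIV. \<Sum>k\<in>UNIV. gu i k z * gu j l z * he f i j z * he f k l z)"
    by (rule sum_rotate)
  also have "\<dots> = (\<Sum>l\<in>UNIV. (\<Sum>k\<in>UNIV. gu i k z * he f l k z) * (\<Sum>j\<in>UNIV. gu l j z * he f i j z))"
    unfolding sum_product
    by (rule sum.cong[OF refl], subst sum.swap)
      (simp add: gu_sym[OF z, of _ "_::'n"] he_sym[OF z f] mult_ac cong: sum.cong)
  finally show "(\<Sum>j\<in>UNIV. \<Sum>k\<in>UNIV. \<Sum>l\<in>UNIV. gu i k z * gu j l z * he f i j z * he f k l z)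
    = (\<Sum>j\<in>UNIV. hend f i j z * hend f j i z)"
    by (simp add: hend_def)
qed

text \<open>The two forms of the quantity \<open>Q\<close>; the second uses \<open>\<nabla>\<^sup>2f(\<nabla>f) = \<nabla>s / 2\<close>.\<close>

lemma quadratic_contraction:
  assumes z: "z \<in> W" and f: "Cinf_on W f"
  shows "(\<Sum>i\<in>UNIV. \<Sum>j\<in>UNIV. \<Sum>k\<in>UNIV. \<Sum>l\<in>UNIV.
        (gu i j z + c * (gr f i z * gr f j z / \<sigma>)) * gu k l z * he f k i z * he f l j z)
    = (\<Sum>i\<in>UNIV. \<Sum>j\<in>UNIV. hend f i j z * hend f j i z) + c * (grad_sq (grad_sq f) z / 4 / \<sigma>)"
proof -
  let ?S = "\<lambda>t :: 'n \<Rightarrow> 'n \<Rightarrow> 'n \<Rightarrow> 'n \<Rightarrow> real. \<Sum>i\<in>UNIV. \<Sum>j\<in>UNIV. \<Sum>k\<in>UNIV. \<Sum>l\<in>UNIV. t i j k l"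
  have "?S (\<lambda>i j k l. (gu i j z + c * (gr f i z * gr f j z / \<sigma>)) * gu k l z * he f k i z * he f l j z)
      = ?S (\<lambda>i j k l. gu i j z * gu k l z * he f k i z * he f l j z)
        + c / \<sigma> * ?S (\<lambda>i j k l. gr f i z * gr f j z * gu k l z * he f k i z * he f l j z)"
    by (simp add: algebra_simps sum.distrib sum_distrib_left)
  also have "?S (\<lambda>i j k l. gu i j z * gu k l z * he f k i z * he f l j z)
      = (\<Sum>i\<in>UNIV. \<Sum>k\<in>UNIV. \<Sum>j\<in>UNIV. \<Sum>l\<in>UNIV. gu i j z * gu k l z * he f k i z * he f l j z)"
    by (rule sum.cong[OF refl], rule sum.swap)
  also have "\<dots> = (\<Sum>i\<in>UNIV. \<Sum>j\<in>UNIV. \<Sum>k\<in>UNIV. \<Sum>l\<in>UNIV. gu i k z * gu j l z * he f i j z * he f k l z)"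
    by (simp add: he_sym[OF z f] cong: sum.cong)
  also have "\<dots> = (\<Sum>i\<in>UNIV. \<Sum>j\<in>UNIV. hend f i j z * hend f j i z)"
    by (rule hess_contraction[OF z f])
  also have "?S (\<lambda>i j k l. gr f i z * gr f j z * gu k l z * he f k i z * he f l j z)
      = (\<Sum>k\<in>UNIV. \<Sum>i\<in>UNIV. \<Sum>j\<in>UNIV. \<Sum>l\<in>UNIV. gr f i z * gr f j z * gu k l z * he f k i z * he f l j z)"
    by (rule sum_rotate)
  also have "\<dots> = (\<Sum>k\<in>UNIV. \<Sum>l\<in>UNIV. \<Sum>i\<in>UNIV. \<Sum>j\<in>UNIV. gr f i z * gr f j z * gu k l z * he f k i z * he f l j z)"
    by (rule sum.cong[OF refl], rule sum_rotate)
  also have "\<dots> = (\<Sum>k\<in>UNIV. \<Sum>l\<in>UNIV. gu k l z * ((\<Sum>i\<in>UNIV. he f k i z * gr f i z) * (\<Sum>j\<in>UNIV. he f l j z * gr f j z)))"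
    unfolding sum_product by (simp add: sum_distrib_left mult_ac)
  also have "\<dots> = (\<Sum>k\<in>UNIV. \<Sum>l\<in>UNIV. gu k l z * (d k (grad_sq f) z / 2 * (d l (grad_sq f) z / 2)))"
    by (simp add: d_grad_sq[OF z f])
  also have "\<dots> = grad_sq (grad_sq f) z / 4"
    by (simp add: grad_sq_def[of "grad_sq f"] gr_def[of "grad_sq f"] sum_distrib_left sum_divide_distrib mult_ac)
  finally show ?thesis by simp
qed

lemma ip_gr:
  assumes z: "z \<in> W"
  shows "(\<Sum>i\<in>UNIV. \<Sum>j\<in>UNIV. gl i j z * gr f i z * Y j) = (\<Sum>j\<in>UNIV. d j f z * Y j)"
  by (subst sum.swap)
    (simp add: sum_distrib_right[symmetric] gl_sym[OF z, of "_::'n"] lower_gr[OF z, symmetric] cong: sum.cong)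

end

section \<open>Time derivatives and the evolution identity\<close>

text \<open>\<open>e0\<close> is the time direction.\<close>

locale static_metric_coords = metric_coords W e gl gu
  for W :: "'e::euclidean_space set" and e :: "'n::finite \<Rightarrow> 'e" and gl gu +
  fixes e0 :: 'e
  assumes e0: "e0 \<in> Basis" "e0 \<notin> range e"
    and dt_gl: "z \<in> W \<Longrightarrow> D e0 (gl i j) z = 0"
    and dt_gu: "z \<in> W \<Longrightarrow> D e0 (gu i j) z = 0"
begin

lemma e0_simp [simp]: "e0 \<in> Basis" by (rule e0)

text \<open>The connection inherits the independence of time from the metric. This is why time differentiation
  commutes with the covariant calculus in the lemmas that follow.\<close>

lemma dt_\<Gamma>:
  assumes z: "z \<in> W"
  shows "D e0 (\<Gamma> k i j) z = 0"
proof -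
  have *: "D e0 (d l (gl i j)) z = 0" for l i j
  proof -
    have "D e0 (d l (gl i j)) z = d l (D e0 (gl i j)) z" by (rule d_commute[OF z]) simp_all
    also have "\<dots> = d l (\<lambda>z. 0) z" by (rule DW_cong[OF z]) (simp_all add: dt_gl)
    finally show ?thesis by simp
  qed
  show ?thesis unfolding \<Gamma>_def[abs_def]
    by (subst DW_mult[OF z]) (simp_all add: DW z * dt_gu)
qed

lemma dt_gr:
  assumes z: "z \<in> W" and f: "Cinf_on W f"
  shows "D e0 (gr f i) z = gr (D e0 f) i z"
  unfolding gr_def[abs_def] by (simp add: DW z f dt_gu d_commute[OF z f, of e0 "e _"])

lemma dt_he:
  assumes z: "z \<in> W" and f: "Cinf_on W f"
  shows "D e0 (he f i j) z = he (D e0 f) i j z"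
proof -
  have "D e0 (d i (d j f)) z = d i (D e0 (d j f)) z" by (rule d_commute[OF z]) (simp_all add: f)
  also have "\<dots> = d i (d j (D e0 f)) z"
    by (rule DW_cong[OF z]) (simp_all add: f d_commute[OF _ f, of _ e0 "e j"])
  finally have "D e0 (d i (d j f)) z = d i (d j (D e0 f)) z" .
  then show ?thesis
    unfolding he_def[abs_def] by (simp add: DW z f dt_\<Gamma> d_commute[OF z f, of e0 "e _"])
qed

lemma dt_Lap:
  assumes z: "z \<in> W" and f: "Cinf_on W f"
  shows "D e0 (Lap f) z = Lap (D e0 f) z"
  unfolding Lap_def[abs_def] by (simp add: DW z f dt_gu dt_he)

lemma dt_grad_sq:
  assumes z: "z \<in> W" and f: "Cinf_on W f"
  shows "D e0 (grad_sq f) z = 2 * (\<Sum>i\<in>UNIV. gr f i z * d i (D e0 f) z)"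
proof -
  have "D e0 (grad_sq f) z = (\<Sum>i\<in>UNIV. gr f i z * d i (D e0 f) z) + (\<Sum>i\<in>UNIV. d i f z * gr (D e0 f) i z)"
    unfolding grad_sq_def[abs_def]
    by (simp add: DW z f dt_gr d_commute[OF z f, of e0 "e _"] sum.distrib mult.commute)
  then show ?thesis using sum_d_gr[OF z, of f "D e0 f"] by simp
qed

text \<open>Differentiating both gradients in \<open>\<nabla>\<^sup>2f(\<nabla>f,\<nabla>f)\<close> gives \<open>2 \<nabla>\<^sup>2f(\<nabla>f, \<nabla>f\<^sub>t) = \<langle>\<nabla>s, \<nabla>f\<^sub>t\<rangle>\<close>.\<close>

lemma dt_he_grad_self:
  assumes z: "z \<in> W" and f: "Cinf_on W f"
  shows "D e0 (he_grad f f) z = he_grad f (D e0 f) z + (\<Sum>k\<in>UNIV. gr (grad_sq f) k z * d k (D e0 f) z)"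
proof -
  let ?ft = "D e0 f"
  have "D e0 (he_grad f f) z = (\<Sum>i\<in>UNIV. \<Sum>j\<in>UNIV. gr ?ft i z * gr f j z * he f i j z)
      + (\<Sum>i\<in>UNIV. \<Sum>j\<in>UNIV. gr f i z * gr ?ft j z * he f i j z) + he_grad f ?ft z"
    unfolding he_grad_def[abs_def]
    by (simp add: DW z f dt_gr dt_he sum.distrib distrib_right)
  also have "(\<Sum>i\<in>UNIV. \<Sum>j\<in>UNIV. gr f i z * gr ?ft j z * he f i j z)
      = (\<Sum>i\<in>UNIV. \<Sum>j\<in>UNIV. gr ?ft i z * gr f j z * he f i j z)"
    by (subst sum.swap) (simp add: he_sym[OF z f] mult_ac)
  also have "(\<Sum>i\<in>UNIV. \<Sum>j\<in>UNIV. gr ?ft i z * gr f j z * he f i j z)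
      = (1/2) * (\<Sum>i\<in>UNIV. d i (grad_sq f) z * gr ?ft i z)"
    by (simp add: d_grad_sq[OF z f] sum_distrib_left sum_distrib_right mult_ac)
  finally show ?thesis using sum_d_gr[OF z, of "grad_sq f" ?ft] by simp
qed

text \<open>The equation for \<open>v\<close> is known only at times \<open>t \<le> T\<close>, hence at \<open>t = T\<close> not on a neighbourhood in space-time;
  spatial derivatives need it only on the time slice through the point.\<close>

lemma d_slice:
  assumes "z \<in> W" "Cinf_on W f" "Cinf_on W f'"
    and "\<And>x. x \<in> W \<Longrightarrow> x \<bullet> e0 = z \<bullet> e0 \<Longrightarrow> f x = f' x"
  shows "d i f z = d i f' z"
proof (rule D_eq_of_eq_on_line)
  have "e i \<bullet> e0 = 0" using e0 e by (metis inner_not_same_Basis rangeI)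
  moreover have "\<forall>\<^sub>F r in nhds (0::real). z + r *\<^sub>R e i \<in> W"
  proof -
    have "((\<lambda>r. z + r *\<^sub>R e i) \<longlongrightarrow> z + 0 *\<^sub>R e i) (nhds 0)"
      by (intro tendsto_intros filterlim_ident)
    then show ?thesis using topological_tendstoD[OF _ W] assms(1) by fastforce
  qed
  ultimately show "\<forall>\<^sub>F r in nhds 0. f (z + r *\<^sub>R e i) = f' (z + r *\<^sub>R e i)"
    by (auto elim!: eventually_mono simp: assms(4) inner_add_left)
qed (use assms in \<open>auto intro: Cinf_on_differentiable\<close>)

lemma he_slice:
  assumes z: "z \<in> W" and f: "Cinf_on W f" "Cinf_on W f'"
    and eq: "\<And>x. x \<in> W \<Longrightarrow> x \<bullet> e0 = z \<bullet> e0 \<Longrightarrow> f x = f' x"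
  shows "he f i j z = he f' i j z"
proof -
  have "d j f x = d j f' x" if "x \<in> W" "x \<bullet> e0 = z \<bullet> e0" for x j
    by (rule d_slice[OF that(1) f]) (use eq that in auto)
  then have "d i (d j f) z = d i (d j f') z"
    by (intro d_slice[OF z]) (simp_all add: f)
  moreover have "d k f z = d k f' z" for k
    by (rule d_slice[OF z f eq])
  ultimately show ?thesis by (simp add: he_def)
qed

lemma he_comp:
  assumes z: "z \<in> W" and s: "Cinf_on W s" "s ` W \<subseteq> J" and h: "Cinf_on J h"
  shows "d i (\<lambda>x. h (s x)) z = D 1 h (s z) * d i s z"
    "he (\<lambda>x. h (s x)) i j z = D 1 h (s z) * he s i j z + D 1 (D 1 h) (s z) * (d i s z * d j s z)"
proof -
  have h1: "Cinf_on J (D 1 h)" by (simp add: Cinf_on_D[OF h])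
  have c: "Cinf_on W (\<lambda>x. k (s x))" if "Cinf_on J k" for k :: "real \<Rightarrow> real"
    by (rule Cinf_on_comp_real[OF W that s(1)]) (use s in auto)
  have 1: "D b (\<lambda>x. k (s x)) x = D 1 k (s x) * D b s x" if "x \<in> W" "Cinf_on J k"
    for x b and k :: "real \<Rightarrow> real"
    using that s by (intro D_comp_real Cinf_on_differentiable[of J] Cinf_on_differentiable[of W]) auto
  show "d i (\<lambda>x. h (s x)) z = D 1 h (s z) * d i s z" by (rule 1[OF z h])
  have "d i (d j (\<lambda>x. h (s x))) z = d i (\<lambda>x. D 1 h (s x) * d j s x) z"
    by (rule DW_cong[OF z]) (simp_all add: c[OF h] 1[OF _ h])
  also have "\<dots> = D 1 (D 1 h) (s z) * d i s z * d j s z + D 1 h (s z) * d i (d j s) z"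
    by (simp add: DW z c[OF h1] s 1[OF _ h1])
  finally show "he (\<lambda>x. h (s x)) i j z
      = D 1 h (s z) * he s i j z + D 1 (D 1 h) (s z) * (d i s z * d j s z)"
    unfolding he_def 1[OF z h]
    by (simp add: right_diff_distrib sum_distrib_left mult_ac)
qed

text \<open>The operator \<open>L\<^sub>\<epsilon>\<close> with coefficients formed from \<open>f\<close>, where \<open>c = p - 2\<close> and \<open>a = \<epsilon>\<^sup>2\<close>.\<close>

definition Leps :: "real \<Rightarrow> real \<Rightarrow> ('e \<Rightarrow> real) \<Rightarrow> ('e \<Rightarrow> real) \<Rightarrow> 'e \<Rightarrow> real" where
  "Leps c a f \<phi> z = Lap \<phi> z + c * (he_grad f \<phi> z / (grad_sq f z + a))"

text \<open>The hypothesis is the shape of the Hessian of \<open>f\<^sub>t = h(s) - w\<close>, with \<open>\<psi> = s\<close> and \<open>\<omega> = w\<close>.\<close>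

lemma Leps_linear_comb:
  assumes "\<And>i j. he \<phi> i j z = \<alpha> * he \<psi> i j z + \<beta> * (d i \<psi> z * d j \<psi> z) - he \<omega> i j z"
  shows "Leps c a f \<phi> z = \<alpha> * Leps c a f \<psi> z
    + \<beta> * (grad_sq \<psi> z + c * ((\<Sum>k\<in>UNIV. gr f k z * d k \<psi> z)\<^sup>2 / (grad_sq f z + a))) - Leps c a f \<omega> z"
proof -
  have L: "Lap \<phi> z = \<alpha> * Lap \<psi> z + \<beta> * grad_sq \<psi> z - Lap \<omega> z"
    unfolding Lap_def grad_sq_def gr_def assms
    by (simp add: algebra_simps sum.distrib sum_subtractf sum_distrib_left)
  have N: "he_grad f \<phi> z = \<alpha> * he_grad f \<psi> z + \<beta> * (\<Sum>k\<in>UNIV. gr f k z * d k \<psi> z)\<^sup>2 - he_grad f \<omega> z"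
    unfolding he_grad_def assms power2_eq_square sum_product
    by (simp add: algebra_simps sum.distrib sum_subtractf sum_distrib_left)
  show ?thesis
    unfolding Leps_def L N by (simp add: algebra_simps add_divide_distrib diff_divide_distrib)
qed

text \<open>The components of \<open>A\<^sub>\<epsilon>\<close>, written with \<open>\<nabla>\<^sup>2f(\<nabla>f) = \<nabla>|\<nabla>f|\<^sup>2 / 2\<close>.\<close>

definition drift :: "real \<Rightarrow> real \<Rightarrow> (real \<Rightarrow> real) \<Rightarrow> ('e \<Rightarrow> real) \<Rightarrow> 'n \<Rightarrow> 'e \<Rightarrow> real" where
  "drift c a K f i z = D 1 K (grad_sq f z) * gr f i z
     + c * (gr (grad_sq f) i z / 2 / (grad_sq f z + a) - he_grad f f z / (grad_sq f z + a)\<^sup>2 * gr f i z)"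

lemma cinf_drift:
  assumes f: "Cinf_on W f" and K: "Cinf_on J K" "grad_sq f ` W \<subseteq> J"
    and pos: "\<And>x. x \<in> W \<Longrightarrow> grad_sq f x + a > 0"
  shows "Cinf_on W (drift c a K f i)"
proof -
  have 1: "Cinf_on W (\<lambda>z. D 1 K (grad_sq f z))"
    by (rule Cinf_on_comp_real[OF W Cinf_on_D[OF K(1)]]) (use K(2) f in auto)
  have nz: "grad_sq f x + a \<noteq> 0" if "x \<in> W" for x using pos[OF that] by simp
  have 2: "Cinf_on W (\<lambda>z. gr (grad_sq f) i z / 2 / (grad_sq f z + a))"
    by (rule Cinf_on_divide[OF W Cinf_on_divide[OF W]]) (simp_all add: f nz)
  have 3: "Cinf_on W (\<lambda>z. he_grad f f z / (grad_sq f z + a)\<^sup>2)"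
    by (rule Cinf_on_divide[OF W _ Cinf_on_power[OF W]]) (simp_all add: f nz)
  show ?thesis
    unfolding drift_def
    by (rule Cinf_on_add[OF W Cinf_on_mult[OF W 1] Cinf_on_mult[OF W Cinf_on_const
          Cinf_on_diff[OF W 2 Cinf_on_mult[OF W 3]]]]) (simp_all add: f)
qed

lemma sum_d_drift:
  assumes z: "z \<in> W"
  shows "(\<Sum>j\<in>UNIV. d j w z * drift c a K f j z)
    = D 1 K (grad_sq f z) * (\<Sum>k\<in>UNIV. gr f k z * d k w z)
       + c * ((\<Sum>k\<in>UNIV. gr (grad_sq f) k z * d k w z) / 2 / (grad_sq f z + a)
               - he_grad f f z / (grad_sq f z + a)\<^sup>2 * (\<Sum>k\<in>UNIV. gr f k z * d k w z))"
  unfolding drift_def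
  by (simp add: algebra_simps sum.distrib sum_subtractf sum_distrib_left sum_divide_distrib)

text \<open>Write \<open>P = \<nabla>\<^sup>2f(\<nabla>f,\<nabla>f)\<close>, so that \<open>- w = \<Delta>f + c P / \<sigma>\<close>. The derivative \<open>w\<^sub>t\<close> equals \<open>- L f\<^sub>t\<close> up to the terms in
  which the coefficients are differentiated, and \<open>f\<^sub>t = h(s) - w\<close> turns \<open>L w + L f\<^sub>t\<close> into \<open>L (h(s))\<close>. Hence
  \<open>L w - w\<^sub>t = L (h(s)) + c (\<langle>\<nabla>s, \<nabla>f\<^sub>t\<rangle> / \<sigma> - 2 P \<langle>\<nabla>f, \<nabla>f\<^sub>t\<rangle> / \<sigma>\<^sup>2)\<close>. The Bochner formula and its counterpart
  express \<open>L s\<close> through \<open>Q\<close>, the Ricci term, \<open>\<langle>\<nabla>f, \<nabla>w\<rangle>\<close> and terms in \<open>\<nabla>s\<close>; with \<open>\<nabla>f\<^sub>t = h'(s) \<nabla>s - \<nabla>w\<close> the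
  latter cancel against the bracket. The names abbreviate the scalars in which this cancellation is
  a polynomial identity: \<open>x = |\<nabla>s|\<^sup>2\<close>, \<open>y = \<langle>\<nabla>f, \<nabla>w\<rangle>\<close>, \<open>r = \<langle>\<nabla>s, \<nabla>w\<rangle>\<close>.\<close>

theorem evolution_identity:
  fixes c a :: real
  assumes z: "z \<in> W" and f: "Cinf_on W f"
    and pos: "\<And>x. x \<in> W \<Longrightarrow> grad_sq f x + a > 0"
    and h: "Cinf_on J h" "grad_sq f ` W \<subseteq> J"
    and w: "\<And>x. w x = - Leps c a f f x"
    and pde: "\<And>x. x \<in> W \<Longrightarrow> x \<bullet> e0 = z \<bullet> e0 \<Longrightarrow> D e0 f x = h (grad_sq f x) - w x"
  defines "s \<equiv> grad_sq f" and "\<sigma> \<equiv> grad_sq f z + a"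
  shows "Leps c a f w z - D e0 w z =
      2 * D 1 h (s z) * ((\<Sum>i\<in>UNIV. \<Sum>j\<in>UNIV. hend f i j z * hend f j i z) + c * (grad_sq s z / 4 / \<sigma>)
         + (\<Sum>j\<in>UNIV. \<Sum>k\<in>UNIV. ric j k z * gr f j z * gr f k z))
      + D 1 (D 1 h) (s z) * (grad_sq s z + c * ((\<Sum>k\<in>UNIV. gr f k z * d k s z)\<^sup>2 / \<sigma>))
      - 2 * (D 1 h (s z) * (\<Sum>k\<in>UNIV. gr f k z * d k w z)
         + c * ((\<Sum>k\<in>UNIV. gr s k z * d k w z) / 2 / \<sigma>
                 - he_grad f f z / \<sigma>\<^sup>2 * (\<Sum>k\<in>UNIV. gr f k z * d k w z)))"
proof -
  define h1 h2 P x y r where "h1 = D 1 h (s z)" and "h2 = D 1 (D 1 h) (s z)" and "P = he_grad f f z"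
    and "x = grad_sq s z" and "y = (\<Sum>k\<in>UNIV. gr f k z * d k w z)" and "r = (\<Sum>k\<in>UNIV. gr s k z * d k w z)"
  define KK R u q where "KK = (\<Sum>i\<in>UNIV. \<Sum>j\<in>UNIV. hend f i j z * hend f j i z)"
    and "R = (\<Sum>j\<in>UNIV. \<Sum>k\<in>UNIV. ric j k z * gr f j z * gr f k z)"
    and "u = (\<Sum>j\<in>UNIV. gr f j z * d j (Lap f) z)"
    and "q = (\<Sum>j\<in>UNIV. gr f j z * d j (he_grad f f) z)"
  have \<sigma>: "\<sigma> > 0" using pos[OF z] by (simp add: \<sigma>_def)
  have \<sigma>nz: "grad_sq f x + a \<noteq> 0" if "x \<in> W" for x using pos[OF that] by simp
  have sW: "Cinf_on W s" unfolding s_def by (simp add: f)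
  define t where "t x = he_grad f f x / (grad_sq f x + a)" for x
  have wdef: "w = (\<lambda>x. - (Lap f x + c * t x))" by (simp add: w Leps_def t_def fun_eq_iff)
  have tW: "Cinf_on W t"
    unfolding t_def by (rule Cinf_on_divide[OF W]) (simp_all add: f \<sigma>nz)
  have wW: "Cinf_on W w" unfolding wdef by (simp add: f tW)
  have ftW: "Cinf_on W (D e0 f)" by (simp add: f)
  have sJ: "s ` W \<subseteq> J" using h(2) by (simp add: s_def)
  have hsW: "Cinf_on W (\<lambda>x. h (s x))"
    by (rule Cinf_on_comp_real[OF W h(1) sW]) (use h(2) s_def in auto)
  have Dw: "D b w z = - (D b (Lap f) z + c * (D b (he_grad f f) z / \<sigma> - P * D b s z / \<sigma>\<^sup>2))" for b
  proof -
    have "D b t z = D b (he_grad f f) z / (grad_sq f z + a) - he_grad f f z * D b (\<lambda>x. grad_sq f x + a) z / (grad_sq f z + a)\<^sup>2"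
      unfolding t_def by (rule D_divide) (use z f \<sigma>nz in \<open>auto intro: Cinf_on_differentiable[of W]\<close>)
    also have "D b (\<lambda>x. grad_sq f x + a) z = D b s z" by (simp add: DW z f s_def)
    finally have "D b t z = D b (he_grad f f) z / \<sigma> - P * D b s z / \<sigma>\<^sup>2" by (simp add: \<sigma>_def P_def)
    then show ?thesis unfolding wdef by (simp add: DW z f tW)
  qed
  have P: "(\<Sum>k\<in>UNIV. gr f k z * d k s z) = 2 * P"
    using he_grad_self[OF z f] by (simp add: P_def s_def)
  \<comment> \<open>The third derivatives of \<open>f\<close> in \<open>u\<close> and \<open>q\<close> enter only through \<open>\<langle>\<nabla>f, \<nabla>w\<rangle>\<close>.\<close>
  have "y = - (\<Sum>k\<in>UNIV. gr f k z * d k (Lap f) z + c * (gr f k z * d k (he_grad f f) z / \<sigma>)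
        - c * (P * (gr f k z * d k s z) / \<sigma>\<^sup>2))"
    unfolding y_def Dw sum_negf[symmetric] by (rule sum.cong) (simp_all add: algebra_simps)
  also have "\<dots> = - (u + c * (q / \<sigma>) - c * (P * (\<Sum>k\<in>UNIV. gr f k z * d k s z) / \<sigma>\<^sup>2))"
    unfolding u_def q_def
    by (simp add: sum.distrib sum_subtractf sum_distrib_left sum_divide_distrib)
  finally have y: "y = - (u + c * (q / \<sigma> - 2 * P\<^sup>2 / \<sigma>\<^sup>2))"
    unfolding P by (simp add: algebra_simps power2_eq_square)
  have ft: "d k (D e0 f) z = h1 * d k s z - d k w z" for k
  proof -
    have "d k (D e0 f) z = d k (\<lambda>x. h (s x) - w x) z"
      by (rule d_slice[OF z ftW]) (simp_all add: hsW[unfolded s_def] wW pde s_def)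
    then show ?thesis
      by (simp add: DW z hsW wW h1_def he_comp(1)[OF z sW sJ h(1)])
  qed
  have heft: "he (D e0 f) i j z = h1 * he s i j z + h2 * (d i s z * d j s z) - he w i j z" for i j
  proof -
    have "he (D e0 f) i j z = he (\<lambda>x. h (s x) - w x) i j z"
      by (rule he_slice[OF z ftW]) (simp_all add: hsW[unfolded s_def] wW pde s_def)
    also have "\<dots> = he (\<lambda>x. h (s x)) i j z - he w i j z"
    proof -
      have "d i (d j (\<lambda>x. h (s x) - w x)) z = d i (\<lambda>x. d j (\<lambda>x. h (s x)) x - d j w x) z"
        by (rule DW_cong[OF z]) (simp_all add: DW hsW wW)
      then show ?thesis
        unfolding he_def by (simp add: DW z hsW wW right_diff_distrib sum_subtractf)
    qed
    finally show ?thesis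
      by (simp add: h1_def h2_def he_comp(2)[OF z sW sJ h(1)])
  qed
  have Lft: "Leps c a f (D e0 f) z = h1 * Leps c a f s z + h2 * (x + c * ((2 * P)\<^sup>2 / \<sigma>)) - Leps c a f w z"
    using Leps_linear_comb[OF heft] by (simp add: x_def P \<sigma>_def)
  have Ls: "Leps c a f s z = 2 * KK + 2 * u + 2 * R + c * ((2 * q - x / 2) / \<sigma>)"
    unfolding Leps_def s_def bochner[OF z f] he_grad_grad_sq[OF z f]
    by (simp add: KK_def u_def R_def q_def x_def \<sigma>_def s_def)
  have dsft: "(\<Sum>k\<in>UNIV. gr s k z * d k (D e0 f) z) = h1 * x - r"
    unfolding ft x_def r_def grad_sq_def[of s]
    by (simp add: right_diff_distrib sum_subtractf sum_distrib_left mult_ac)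
  have "(\<Sum>k\<in>UNIV. gr f k z * d k (D e0 f) z) = h1 * (\<Sum>k\<in>UNIV. gr f k z * d k s z) - y"
    unfolding ft y_def by (simp add: right_diff_distrib sum_subtractf sum_distrib_left mult_ac)
  then have Gft: "(\<Sum>k\<in>UNIV. gr f k z * d k (D e0 f) z) = h1 * (2 * P) - y" by (simp add: P)
  have "D e0 w z = - (Lap (D e0 f) z + c * ((he_grad f (D e0 f) z + (h1 * x - r)) / \<sigma>
      - P * (2 * (h1 * (2 * P) - y)) / \<sigma>\<^sup>2))"
    unfolding Dw dt_Lap[OF z f] dt_he_grad_self[OF z f] s_def dt_grad_sq[OF z f] Gft
    using dsft by (simp add: s_def)
  then have Dtw: "D e0 w z = - (Leps c a f (D e0 f) z) - c * ((h1 * x - r) / \<sigma>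
      - P * (2 * (h1 * (2 * P) - y)) / \<sigma>\<^sup>2)"
    by (simp add: Leps_def \<sigma>_def add_divide_distrib diff_divide_distrib algebra_simps)
  have "Leps c a f w z - D e0 w z = h1 * Leps c a f s z + h2 * (x + c * ((2 * P)\<^sup>2 / \<sigma>))
      + c * ((h1 * x - r) / \<sigma> - P * (2 * (h1 * (2 * P) - y)) / \<sigma>\<^sup>2)"
    unfolding Dtw Lft by simp
  also have "h1 * Leps c a f s z
      = h1 * (2 * KK + 2 * R - 2 * y + c * (4 * P\<^sup>2 / \<sigma>\<^sup>2 - x / 2 / \<sigma>))"
    unfolding Ls y by (simp add: algebra_simps add_divide_distrib diff_divide_distrib)
  also have "h1 * (2 * KK + 2 * R - 2 * y + c * (4 * P\<^sup>2 / \<sigma>\<^sup>2 - x / 2 / \<sigma>))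
      + h2 * (x + c * ((2 * P)\<^sup>2 / \<sigma>))
      + c * ((h1 * x - r) / \<sigma> - P * (2 * (h1 * (2 * P) - y)) / \<sigma>\<^sup>2)
    = 2 * h1 * (KK + c * (x / 4 / \<sigma>) + R) + h2 * (x + c * ((2 * P)\<^sup>2 / \<sigma>))
      - 2 * (h1 * y + c * (r / 2 / \<sigma> - P / \<sigma>\<^sup>2 * y))"
  proof -
    \<comment> \<open>Both sides agree as polynomials in \<open>1 / \<sigma>\<close>, so no denominators have to be cleared.\<close>
    define i where "i = 1 / \<sigma>"
    have i: "X / \<sigma> = X * i" "X / \<sigma>\<^sup>2 = X * (i * i)" for X
      by (simp_all add: i_def power2_eq_square)
    show ?thesis unfolding i by (simp add: algebra_simps power2_eq_square)
  qed
  finally show ?thesis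
    unfolding P h1_def[symmetric] h2_def[symmetric] x_def[symmetric] y_def[symmetric]
      r_def[symmetric] KK_def[symmetric] R_def[symmetric] P_def[symmetric] .
qed

end

section \<open>From a chart to coordinates\<close>

context riemannian_manifold
begin

lemma cmap_inj_on: "c \<in> \<A> \<Longrightarrow> inj_on (cmap c) (cdom c)"
  and open_cimg: "c \<in> \<A> \<Longrightarrow> open (cimg c)"
proof -
  assume "c \<in> \<A>"
  then have c: "is_chart X c" by (rule charts)
  then show "open (cimg c)" by (simp add: is_chart_def)
  have "cdom c \<subseteq> topspace X" using c by (simp add: is_chart_def openin_subset)
  then show "inj_on (cmap c) (cdom c)"
    using c homeomorphic_imp_injective_map[of "subtopology X (cdom c)" "top_of_set (cimg c)" "cmap c"]
    by (simp add: is_chart_def topspace_subtopology Int_absorb1)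
qed

lemma cinv_cmap: "c \<in> \<A> \<Longrightarrow> x \<in> cdom c \<Longrightarrow> cinv c (cmap c x) = x"
  unfolding cinv_def by (rule inv_into_f_f[OF cmap_inj_on])

lemma cmap_cinv: "y \<in> cimg c \<Longrightarrow> cmap c (cinv c y) = y"
  unfolding cinv_def by (rule f_inv_into_f)

lemma cinv_in_cdom: "y \<in> cimg c \<Longrightarrow> cinv c y \<in> cdom c"
  unfolding cinv_def by (rule inv_into_into)

lemma metric_invertible:
  assumes c: "c \<in> \<A>" and x: "x \<in> cdom c"
  shows "invertible (g c x)"
proof -
  have "Y = 0" if "g c x *v Y = 0" for Y
  proof (rule ccontr)
    assume "Y \<noteq> 0"
    then have "0 < ip g c x Y Y" by (rule metric_pos[OF c x])
    also have "ip g c x Y Y = (\<Sum>i\<in>UNIV. Y $ i * (g c x *v Y) $ i)"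
      unfolding ip_def matrix_vector_mult_def by (simp add: sum_distrib_left mult_ac)
    finally show False using that by simp
  qed
  then show ?thesis
    unfolding invertible_left_inverse matrix_left_invertible_ker by blast
qed

end

text \<open>A product neighbourhood in the image of a chart, together with a smooth function \<open>F\<close> on it that
  agrees with \<open>v\<close> up to time \<open>T\<close>. Replacing \<open>v\<close> by \<open>F\<close> makes two-sided time derivatives available at
  \<open>t = T\<close>, where the coordinate calculus needs a function on an open set of space-time.\<close>

locale chart_patch = riemannian_manifold X \<A> g
  for X :: "'a topology" and \<A> :: "('a, 'n::finite) chart set" and g :: "('a, 'n) metric" +
  fixes c :: "('a, 'n) chart" and N :: "(real^'n) set" and I :: "real set" and T :: real
    and v :: "real \<Rightarrow> 'a \<Rightarrow> real" and F :: "(real^'n) \<times> real \<Rightarrow> real"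
  assumes c: "c \<in> \<A>" and N: "open N" "N \<subseteq> cimg c" and I: "open I" "I \<subseteq> {0<..}"
    and metric_on_N: "Cinf_on N (\<lambda>y. g c (cinv c y) $ i $ j)"
    and F: "Cinf_on (N \<times> I) F"
    and F_eq: "y \<in> N \<Longrightarrow> \<tau> \<in> I \<Longrightarrow> \<tau> \<le> T \<Longrightarrow> v \<tau> (cinv c y) = F (y, \<tau>)"
begin

lemma cinv_N: "y \<in> N \<Longrightarrow> cinv c y \<in> cdom c"
  by (rule cinv_in_cdom) (rule subsetD[OF N(2)])

lemma gsym: "y \<in> N \<Longrightarrow> g c (cinv c y) $ i $ j = g c (cinv c y) $ j $ i"
  using arg_cong[where f="\<lambda>A. A $ i $ j", OF metric_sym[OF c cinv_N, of y]] by (simp add: transpose_def)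

lemma ginv_sym: "y \<in> N \<Longrightarrow> ginv g c (cinv c y) $ i $ j = ginv g c (cinv c y) $ j $ i"
  using arg_cong[where f="\<lambda>A. A $ i $ j",
      OF transpose_matrix_inv[OF metric_invertible metric_sym, OF c cinv_N c cinv_N, of y]]
  by (simp add: ginv_def transpose_def)

lemma D_fst_eq_0:
  assumes "Cinf_on N (f :: _ \<Rightarrow> real)" "z \<in> N \<times> I"
  shows "D (0, 1) (\<lambda>z. f (fst z)) z = 0"
proof -
  have 1: "(fst has_derivative fst) (at z)"
    by (rule bounded_linear_imp_has_derivative[OF bounded_linear_fst])
  have d: "f differentiable (at (fst z))"
    using assms by (intro Cinf_on_differentiable[of N]) auto
  have "D (0, 1) (\<lambda>z. f (fst z)) z = D (fst (0, 1::real)) f (fst z)"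
    by (rule D_eq[OF has_derivative_compose[OF 1 d[unfolded frechet_derivative_works]]])
  then show ?thesis using linear_0[OF linear_frechet_derivative[OF d]] by simp
qed

sublocale static_metric_coords "N \<times> I" "\<lambda>i::'n. (axis i 1, 0)"
  "\<lambda>i j z. g c (cinv c (fst z)) $ i $ j" "\<lambda>i j z. ginv g c (cinv c (fst z)) $ i $ j" "(0, 1)"
proof
  have gi: "Cinf_on N (\<lambda>y. ginv g c (cinv c y) $ i $ j)" for i j
    unfolding ginv_def
    by (rule Cinf_on_matrix_inv[OF N(1)]) (simp_all add: metric_on_N metric_invertible[OF c cinv_N])
  show o: "open (N \<times> I)" using N I by (simp add: open_Times)
  show "(axis i 1, 0) \<in> (Basis :: ((real^'n) \<times> real) set)" for i
    by (auto simp: Basis_prod_def axis_inverse)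
  show "((0, 1) :: (real^'n) \<times> real) \<in> Basis" by (auto simp: Basis_prod_def)
  show "((0, 1) :: (real^'n) \<times> real) \<notin> range (\<lambda>i. (axis i 1, 0))" by auto
  show "Cinf_on (N \<times> I) (\<lambda>z. g c (cinv c (fst z)) $ i $ j)" for i j
    by (rule Cinf_on_fst[OF o metric_on_N]) auto
  show "Cinf_on (N \<times> I) (\<lambda>z. ginv g c (cinv c (fst z)) $ i $ j)" for i j
    by (rule Cinf_on_fst[OF o gi]) auto
  fix z :: "(real^'n) \<times> real" assume z: "z \<in> N \<times> I"
  then have y: "fst z \<in> N" by auto
  show "g c (cinv c (fst z)) $ i $ j = g c (cinv c (fst z)) $ j $ i" for i j by (rule gsym[OF y])
  show "ginv g c (cinv c (fst z)) $ i $ j = ginv g c (cinv c (fst z)) $ j $ i" for i j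
    by (rule ginv_sym[OF y])
  show "(\<Sum>j\<in>UNIV. ginv g c (cinv c (fst z)) $ i $ j * g c (cinv c (fst z)) $ j $ k)
      = (if i = k then 1 else 0)" for i k
    using matrix_inv_inverse(1)[OF metric_invertible[OF c cinv_N[OF y]]]
    unfolding ginv_def matrix_matrix_mult_def mat_def by (simp add: vec_eq_iff)
  show "D (0, 1) (\<lambda>z. g c (cinv c (fst z)) $ i $ j) z = 0" for i j
    by (rule D_fst_eq_0[OF metric_on_N z])
  show "D (0, 1) (\<lambda>z. ginv g c (cinv c (fst z)) $ i $ j) z = 0" for i j
    by (rule D_fst_eq_0[OF gi z])
qed

text \<open>\<open>\<Phi>\<close> is the coordinate expression of \<open>u\<close> at time \<open>\<tau>\<close>. The lemmas below carry this relation through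
  the operations of the Levi-Civita calculus.\<close>

definition represents :: "real \<Rightarrow> ((real^'n) \<times> real \<Rightarrow> real) \<Rightarrow> ('a \<Rightarrow> real) \<Rightarrow> bool" where
  "represents \<tau> \<Phi> u \<longleftrightarrow> (\<forall>y\<in>N. u (cinv c y) = \<Phi> (y, \<tau>))"

lemma representsD: "represents \<tau> \<Phi> u \<Longrightarrow> y \<in> N \<Longrightarrow> u (cinv c y) = \<Phi> (y, \<tau>)"
  by (simp add: represents_def)

lemma represents_v: "\<tau> \<in> I \<Longrightarrow> \<tau> \<le> T \<Longrightarrow> represents \<tau> F (v \<tau>)"
  by (simp add: represents_def F_eq)

lemma represents_pd:
  assumes r: "represents \<tau> \<Phi> u" and \<Phi>: "Cinf_on (N \<times> I) \<Phi>" and \<tau>: "\<tau> \<in> I"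
  shows "represents \<tau> (d i \<Phi>) (pd c i u)"
  unfolding represents_def
proof
  fix y assume y: "y \<in> N"
  have "((\<lambda>y. (y, \<tau>)) has_derivative (\<lambda>b. (b, 0))) (at y)"
    by (auto intro!: derivative_eq_intros)
  moreover have dif: "(\<Phi> has_derivative frechet_derivative \<Phi> (at (y, \<tau>))) (at (y, \<tau>))"
    using Cinf_on_differentiable[OF \<Phi>, of "(y, \<tau>)"] y \<tau> by (simp add: frechet_derivative_works)
  ultimately have *: "((\<lambda>y. \<Phi> (y, \<tau>)) has_derivative (\<lambda>b. D (b, 0) \<Phi> (y, \<tau>))) (at y)"
    using has_derivative_compose by fast
  have "pd c i u (cinv c y) = D (axis i 1) (u \<circ> cinv c) y"
    using y N(2) by (simp add: pd_def cmap_cinv subsetD)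
  also have "\<dots> = D (axis i 1) (\<lambda>y. \<Phi> (y, \<tau>)) y"
    by (rule D_cong[OF N(1) y, symmetric]) (use * representsD[OF r] in \<open>auto simp: differentiable_def\<close>)
  also have "\<dots> = d i \<Phi> (y, \<tau>)" by (rule D_eq[OF *])
  finally show "pd c i u (cinv c y) = d i \<Phi> (y, \<tau>)" .
qed

lemma represents_metric: "represents \<tau> (\<lambda>z. g c (cinv c (fst z)) $ i $ j) (\<lambda>x. g c x $ i $ j)"
  by (simp add: represents_def)

lemma represents_christoffel:
  assumes "\<tau> \<in> I"
  shows "represents \<tau> (\<Gamma> k i j) (christoffel g c k i j)"
  using representsD[OF represents_pd[OF represents_metric gl assms]]
  by (simp add: represents_def christoffel_def \<Gamma>_def)

lemma represents_grad:
  assumes "represents \<tau> \<Phi> u" "Cinf_on (N \<times> I) \<Phi>" "\<tau> \<in> I"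
  shows "represents \<tau> (gr \<Phi> i) (\<lambda>x. grad g c u x $ i)"
  using representsD[OF represents_pd[OF assms]] by (simp add: represents_def grad_def gr_def)

lemma represents_hess:
  assumes "represents \<tau> \<Phi> u" "Cinf_on (N \<times> I) \<Phi>" "\<tau> \<in> I"
  shows "represents \<tau> (he \<Phi> i j) (hess g c i j u)"
  using representsD[OF represents_pd[OF assms]] representsD[OF represents_christoffel[OF assms(3)]]
    representsD[OF represents_pd[OF represents_pd[OF assms] _ assms(3)]] assms(2)
  by (simp add: represents_def hess_def he_def)

lemma Ric_eq:
  assumes "y \<in> N" "\<tau> \<in> I"
  shows "Ric g c (cinv c y) Y Z = (\<Sum>j\<in>UNIV. \<Sum>k\<in>UNIV. ric j k (y, \<tau>) * Y $ j * Z $ k)"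
  using representsD[OF represents_christoffel[OF assms(2)] assms(1)]
    representsD[OF represents_pd[OF represents_christoffel[OF assms(2)] cinf_\<Gamma> assms(2)] assms(1)]
  by (simp add: Ric_def riem_def ric_def)

lemma ip_grad:
  assumes "represents \<tau> \<Phi> u" "Cinf_on (N \<times> I) \<Phi>" "\<tau> \<in> I" "y \<in> N"
  shows "ip g c (cinv c y) (grad g c u (cinv c y)) Y = (\<Sum>j\<in>UNIV. d j \<Phi> (y, \<tau>) * Y $ j)"
  using ip_gr[of "(y, \<tau>)" \<Phi> "\<lambda>j. Y $ j"] representsD[OF represents_grad[OF assms(1-3)] assms(4)] assms(3,4)
  by (simp add: ip_def)

lemma represents_sfun:
  assumes "represents \<tau> \<Phi> u" "Cinf_on (N \<times> I) \<Phi>" "\<tau> \<in> I"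
  shows "represents \<tau> (grad_sq \<Phi>) (sfun g c u)"
  using representsD[OF represents_grad[OF assms]] ip_grad[OF assms]
  by (simp add: represents_def sfun_def grad_sq_def)

lemma grad_sq_nonneg:
  assumes "z \<in> N \<times> I"
  shows "grad_sq \<Phi> z \<ge> 0"
proof -
  define Y :: "real^'n" where "Y = (\<chi> i. gr \<Phi> i z)"
  have y: "cinv c (fst z) \<in> cdom c" using assms cinv_N by auto
  have "grad_sq \<Phi> z = ip g c (cinv c (fst z)) Y Y"
    using ip_gr[OF assms, of \<Phi> "\<lambda>j. gr \<Phi> j z"] by (simp add: ip_def grad_sq_def Y_def)
  then show ?thesis
    using metric_pos[OF c y, of Y] by (cases "Y = 0") (auto simp: ip_def intro: less_imp_le)
qed

lemma represents_Lop:
  assumes u: "represents \<tau> \<Psi> u" "Cinf_on (N \<times> I) \<Psi>"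
    and \<phi>: "represents \<tau> \<Phi> \<phi>" "Cinf_on (N \<times> I) \<Phi>" and \<tau>: "\<tau> \<in> I"
  shows "represents \<tau> (Leps (p - 2) (\<epsilon>\<^sup>2) \<Psi> \<Phi>) (Lop g c p \<epsilon> u \<phi>)"
  using representsD[OF represents_grad[OF u \<tau>]] representsD[OF represents_hess[OF \<phi> \<tau>]]
    representsD[OF represents_sfun[OF u \<tau>]]
  by (simp add: represents_def Lop_def acoef_def sigma_reg_def Leps_def Lap_def he_grad_def
      distrib_right distrib_left sum.distrib sum_distrib_left sum_divide_distrib mult_ac)

lemma represents_hess_end:
  assumes u: "represents \<tau> \<Phi> u" "Cinf_on (N \<times> I) \<Phi>" "\<tau> \<in> I"
  shows "represents \<tau> (\<lambda>z. gr (grad_sq \<Phi>) i z / 2) (\<lambda>x. hess_end g c u x (grad g c u x) $ i)"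
  unfolding represents_def
proof
  fix y assume y: "y \<in> N"
  then have z: "(y, \<tau>) \<in> N \<times> I" using u(3) by simp
  have "hess_end g c u (cinv c y) (grad g c u (cinv c y)) $ i
    = (\<Sum>j\<in>UNIV. ginv g c (cinv c y) $ i $ j * (\<Sum>k\<in>UNIV. he \<Phi> j k (y, \<tau>) * gr \<Phi> k (y, \<tau>)))"
    using representsD[OF represents_grad[OF u] y] representsD[OF represents_hess[OF u] y]
    by (simp add: hess_end_def sum_distrib_left mult_ac)
  also have "\<dots> = gr (grad_sq \<Phi>) i (y, \<tau>) / 2"
    by (simp add: gr_def[of "grad_sq \<Phi>"] d_grad_sq[OF z u(2)] sum_divide_distrib)
  finally show "hess_end g c u (cinv c y) (grad g c u (cinv c y)) $ i = gr (grad_sq \<Phi>) i (y, \<tau>) / 2" .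
qed

lemma represents_hess_bil:
  assumes u: "represents \<tau> \<Phi> u" "Cinf_on (N \<times> I) \<Phi>" "\<tau> \<in> I"
  shows "represents \<tau> (he_grad \<Phi> \<Phi>) (\<lambda>x. hess_bil g c u x (grad g c u x) (grad g c u x))"
  using representsD[OF represents_grad[OF u]] representsD[OF represents_hess[OF u]]
  by (simp add: represents_def hess_bil_def he_grad_def mult_ac)

lemma represents_wfun:
  assumes "\<tau> \<in> I" "\<tau> \<le> T"
  shows "represents \<tau> (\<lambda>z. - Leps (p - 2) (\<epsilon>\<^sup>2) F F z) (wfun g c p \<epsilon> v \<tau>)"
  using representsD[OF represents_Lop[OF represents_v[OF assms] F represents_v[OF assms] F assms(1)]]
  by (simp add: represents_def wfun_def)

text \<open>The one-sided time derivative of \<open>u\<close> at \<open>t = T\<close> is the two-sided one of its smooth extension.\<close>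

lemma tderiv_eq:
  assumes "y \<in> N" "\<tau> \<in> I" "\<tau> \<le> T" and \<Phi>: "Cinf_on (N \<times> I) \<Phi>"
    and r: "\<And>\<tau>. \<tau> \<in> I \<Longrightarrow> \<tau> \<le> T \<Longrightarrow> represents \<tau> \<Phi> (u \<tau>)"
  shows "tderiv T u \<tau> (cinv c y) = D (0, 1) \<Phi> (y, \<tau>)"
  unfolding tderiv_def
proof (rule vector_derivative_within)
  have \<tau>: "0 < \<tau>" using assms(2) I by auto
  have "\<tau> islimpt {0<..T}"
    using islimpt_greaterThanLessThan2[OF \<tau>] by (rule islimpt_subset) (use assms(3) in auto)
  then show "at \<tau> within {0<..T} \<noteq> bot" by (simp add: trivial_limit_within)
  have eq: "(y, 0) + r *\<^sub>R (0, 1) = (y, r)" for r :: real by simp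
  have "((\<lambda>r. \<Phi> ((y, 0) + r *\<^sub>R (0, 1))) has_real_derivative D (0, 1) \<Phi> ((y, 0) + \<tau> *\<^sub>R (0, 1))) (at \<tau>)"
    by (rule has_real_derivative_along_line, unfold eq)
      (rule Cinf_on_differentiable[OF \<Phi>], use assms in auto)
  then have "((\<lambda>r. \<Phi> (y, r)) has_vector_derivative D (0, 1) \<Phi> (y, \<tau>)) (at \<tau> within {0<..T})"
    unfolding eq by (simp add: has_real_derivative_iff_has_vector_derivative has_vector_derivative_at_within)
  moreover have "\<forall>\<^sub>F r in at \<tau> within {0<..T}. \<Phi> (y, r) = u r (cinv c y)"
    unfolding eventually_at_topological
    using I(1) assms(1,2) representsD[OF r] by (intro exI[of _ I]) auto
  moreover have "\<Phi> (y, \<tau>) = u \<tau> (cinv c y)" using representsD[OF r] assms by simp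
  ultimately show "((\<lambda>\<tau>. u \<tau> (cinv c y)) has_vector_derivative D (0, 1) \<Phi> (y, \<tau>)) (at \<tau> within {0<..T})"
    unfolding has_vector_derivative_def
    by (rule has_derivative_transform_eventually) (use assms \<tau> in auto)
qed

end

section \<open>The identity on the manifold\<close>

text \<open>The one-sided derivatives of \<open>h\<close> on \<open>[0,\<infinity>)\<close> are those of a smooth local extension \<open>K\<close>. Since \<open>s \<ge> 0\<close>,
  composing with \<open>s\<close> does not distinguish \<open>h\<close> from \<open>K\<close>, and \<open>K(s)\<close> can be differentiated freely also where
  \<open>\<nabla>v = 0\<close>.\<close>

lemma hderiv_eq:
  assumes J: "open J" "r \<in> J" and r: "0 \<le> r"
    and eq: "\<And>x. x \<in> J \<Longrightarrow> 0 \<le> x \<Longrightarrow> k x = K x" and K: "K differentiable (at r)"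
  shows "hderiv k r = D 1 K r"
  unfolding hderiv_def
proof (rule vector_derivative_within)
  have "r islimpt {r<..<r+1}" by (rule islimpt_greaterThanLessThan1) simp
  then have "r islimpt {0..}" by (rule islimpt_subset) (use r in auto)
  then show "at r within {0..} \<noteq> bot" by (simp add: trivial_limit_within)
  have "(K has_real_derivative D 1 K r) (at r)"
    using has_real_derivative_along_line[of K 0 r 1] K by simp
  then have "(K has_vector_derivative D 1 K r) (at r within {0..})"
    by (simp add: has_real_derivative_iff_has_vector_derivative has_vector_derivative_at_within)
  moreover have "\<forall>\<^sub>F x in at r within {0..}. K x = k x"
    unfolding eventually_at_topological using J eq by (intro exI[of _ J]) auto
  moreover have "K r = k r" using J r eq by simp
  ultimately show "(k has_vector_derivative D 1 K r) (at r within {0..})"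
    unfolding has_vector_derivative_def
    by (rule has_derivative_transform_eventually) (use r in auto)
qed

lemma hderiv2_eq:
  assumes J: "open J" "r \<in> J" and r: "0 \<le> r"
    and eq: "\<And>x. x \<in> J \<Longrightarrow> 0 \<le> x \<Longrightarrow> k x = K x" and K: "Cinf_on J K"
  shows "hderiv (hderiv k) r = D 1 (D 1 K) r"
proof (rule hderiv_eq[OF J r])
  show "hderiv k x = D 1 K x" if "x \<in> J" "0 \<le> x" for x
    by (rule hderiv_eq[OF J(1) that eq Cinf_on_differentiable[OF K that(1)]])
  show "D 1 K differentiable (at r)"
    by (rule Cinf_on_differentiable[OF Cinf_on_D[OF K] J(2)]) simp
qed

context chart_patch
begin

lemma Afield_eq:
  assumes h: "open J" "\<And>x. x \<in> J \<Longrightarrow> 0 \<le> x \<Longrightarrow> h x = K x" "Cinf_on J K" "grad_sq F ` (N \<times> I) \<subseteq> J"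
    and y: "y \<in> N" and \<tau>: "\<tau> \<in> I" "\<tau> \<le> T"
  shows "Afield g c p \<epsilon> h (v \<tau>) (cinv c y) $ i = drift (p - 2) (\<epsilon>\<^sup>2) K F i (y, \<tau>)"
proof -
  have z: "(y, \<tau>) \<in> N \<times> I" using y \<tau> by simp
  note v = represents_v[OF \<tau>] F \<tau>(1)
  have "hderiv h (grad_sq F (y, \<tau>)) = D 1 K (grad_sq F (y, \<tau>))"
    using h(4) z by (intro hderiv_eq[OF h(1) _ _ h(2)] grad_sq_nonneg Cinf_on_differentiable[OF h(3)]) auto
  moreover have "gr (grad_sq F) i (y, \<tau>)
      = 2 * hess_end g c (v \<tau>) (cinv c y) (grad g c (v \<tau>) (cinv c y)) $ i"
    using representsD[OF represents_hess_end[OF v, of i] y] by linarith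
  ultimately show ?thesis
    using representsD[OF represents_sfun[OF v] y] representsD[OF represents_grad[OF v] y]
      representsD[OF represents_hess_bil[OF v] y]
    by (simp add: Afield_def Bfield_def sigma_reg_def drift_def)
qed

lemma Afield_smooth_near:
  assumes h: "open J" "\<And>x. x \<in> J \<Longrightarrow> 0 \<le> x \<Longrightarrow> h x = K x" "Cinf_on J K" "grad_sq F ` (N \<times> I) \<subseteq> J"
    and \<epsilon>: "0 < \<epsilon>" and z: "z \<in> N \<times> I"
  shows "\<exists>W B. open W \<and> z \<in> W \<and> (\<forall>k. Ck_on k W B) \<and>
    (\<forall>x\<in>W \<inter> cimg c \<times> {0<..T}. B x = (\<lambda>(y, t). Afield g c p \<epsilon> h (v t) (cinv c y)) x)"
proof (intro exI conjI)
  define B :: "(real^'n) \<times> real \<Rightarrow> real^'n" where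
    "B x = (\<Sum>i\<in>UNIV. drift (p - 2) (\<epsilon>\<^sup>2) K F i x *\<^sub>R axis i 1)" for x
  show "open (N \<times> I)" using N I by (simp add: open_Times)
  show "z \<in> N \<times> I" by (rule z)
  have pos: "grad_sq F x + \<epsilon>\<^sup>2 > 0" if "x \<in> N \<times> I" for x
    using grad_sq_nonneg[OF that, of F] \<epsilon> by (simp add: add_nonneg_pos)
  have "Cinf_on (N \<times> I) B"
    unfolding B_def
    by (intro Cinf_on_sum[OF W] Cinf_on_bounded_linear[OF W bounded_linear_scaleR_left]
        cinf_drift[OF F h(3,4) pos])
  then show "\<forall>k. Ck_on k (N \<times> I) B" by (simp add: Cinf_on_def)
  have "B (y, \<tau>) = Afield g c p \<epsilon> h (v \<tau>) (cinv c y)" if "y \<in> N" "\<tau> \<in> I" "\<tau> \<le> T" for y \<tau>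
    using Afield_eq[OF h that]
    by (simp add: vec_eq_iff B_def axis_def if_distrib[of "\<lambda>u. _ * u"] cong: if_cong)
  then show "\<forall>x\<in>N \<times> I \<inter> cimg c \<times> {0<..T}. B x = (\<lambda>(y, t). Afield g c p \<epsilon> h (v t) (cinv c y)) x"
    by auto
qed

lemma identity_at_point:
  assumes h: "open J" "\<And>x. x \<in> J \<Longrightarrow> 0 \<le> x \<Longrightarrow> h x = K x" "Cinf_on J K" "grad_sq F ` (N \<times> I) \<subseteq> J"
    and \<epsilon>: "0 < \<epsilon>" and y: "y \<in> N" and t: "t \<in> I" "t \<le> T"
    and pde: "\<And>x. x \<in> cdom c \<Longrightarrow>
      tderiv T v t x = Lop g c p \<epsilon> (v t) (v t) x + h (sfun g c (v t) x)"
  defines "x \<equiv> cinv c y" and "s \<equiv> sfun g c (v t)" and "w \<equiv> wfun g c p \<epsilon> v"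
  defines "G \<equiv> grad g c (v t) x"
  defines "H \<equiv> hess_end g c (v t) x G"
  shows "w t x = h (s x) - tderiv T v t x"
    and "Qop g c p \<epsilon> (v t) x =
              hess_norm2 g c (v t) x + (p - 2) * (ip g c x H H / sigma_reg g c \<epsilon> (v t) x)"
    and "Lop g c p \<epsilon> (v t) (w t) x - tderiv T w t x =
              2 * hderiv h (s x) * (Qop g c p \<epsilon> (v t) x + Ric g c x G G)
              + hderiv (hderiv h) (s x)
                * (\<Sum>i\<in>UNIV. \<Sum>j\<in>UNIV. acoef g c p \<epsilon> (v t) i j x * pd c i s x * pd c j s x)
              - 2 * ip g c x (grad g c (w t) x) (Afield g c p \<epsilon> h (v t) x)"
proof -
  define z where "z = (y, t)"
  define a where "a = \<epsilon>\<^sup>2"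
  define wc where "wc z = - Leps (p - 2) a F F z" for z
  have z: "z \<in> N \<times> I" using y t by (simp add: z_def)
  note vt = represents_v[OF t] F t(1)
  have pos: "grad_sq F x + a > 0" if "x \<in> N \<times> I" for x
    using grad_sq_nonneg[OF that, of F] \<epsilon> by (simp add: add_nonneg_pos a_def)
  have posnz: "grad_sq F x + a \<noteq> 0" if "x \<in> N \<times> I" for x
    using pos[OF that] by simp
  have wc: "Cinf_on (N \<times> I) wc"
    unfolding wc_def Leps_def
    by (intro Cinf_on_uminus[OF W] Cinf_on_add[OF W] Cinf_on_mult[OF W] Cinf_on_const
        Cinf_on_divide[OF W] cinf_Lap cinf_he_grad cinf_grad_sq F posnz)
  have rw: "represents \<tau> wc (w \<tau>)" if "\<tau> \<in> I" "\<tau> \<le> T" for \<tau>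
    using represents_wfun[OF that] unfolding wc_def w_def a_def .
  note wt = rw[OF t] wc t(1)
  have grad: "G $ i = gr F i z" for i
    using representsD[OF represents_grad[OF vt] y] by (simp add: G_def x_def z_def)
  have s: "represents t (grad_sq F) s" unfolding s_def by (rule represents_sfun[OF vt])
  have sx: "s x = grad_sq F z" using representsD[OF s y] by (simp add: x_def z_def)
  have \<sigma>: "sigma_reg g c \<epsilon> (v t) x = grad_sq F z + a"
    using sx by (simp add: sigma_reg_def a_def s_def)
  have ds: "pd c i s x = d i (grad_sq F) z" for i
    using representsD[OF represents_pd[OF s _ t(1)] y] F by (simp add: x_def z_def)
  have he: "hess g c i j (v t) x = he F i j z" for i j
    using representsD[OF represents_hess[OF vt] y] by (simp add: x_def z_def)
  have ginv: "ginv g c x $ i $ j = ginv g c (cinv c (fst z)) $ i $ j" for i j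
    by (simp add: x_def z_def)
  have acoef: "acoef g c p \<epsilon> (v t) i j x
      = ginv g c (cinv c (fst z)) $ i $ j + (p - 2) * (gr F i z * gr F j z / (grad_sq F z + a))" for i j
    using grad by (simp add: acoef_def ginv \<sigma> G_def)
  have H: "H $ i = gr (grad_sq F) i z / 2" for i
    using representsD[OF represents_hess_end[OF vt] y] by (simp add: H_def G_def x_def z_def)
  have norm2: "hess_norm2 g c (v t) x = (\<Sum>i\<in>UNIV. \<Sum>j\<in>UNIV. hend F i j z * hend F j i z)"
    unfolding hess_norm2_def he ginv by (rule hess_contraction[OF z F])
  have Q: "Qop g c p \<epsilon> (v t) x = (\<Sum>i\<in>UNIV. \<Sum>j\<in>UNIV. hend F i j z * hend F j i z)
      + (p - 2) * (grad_sq (grad_sq F) z / 4 / (grad_sq F z + a))"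
    unfolding Qop_def he acoef ginv by (rule quadratic_contraction[OF z F])
  have "ip g c x H H = (\<Sum>i\<in>UNIV. \<Sum>j\<in>UNIV. g c (cinv c (fst z)) $ i $ j * gr (grad_sq F) i z * gr (grad_sq F) j z) / 4"
    unfolding ip_def H by (simp add: x_def z_def sum_divide_distrib)
  also have "\<dots> = grad_sq (grad_sq F) z / 4"
    unfolding ip_gr[OF z] grad_sq_def[of "grad_sq F"] ..
  finally have HH: "ip g c x H H = grad_sq (grad_sq F) z / 4" .
  show "Qop g c p \<epsilon> (v t) x =
      hess_norm2 g c (v t) x + (p - 2) * (ip g c x H H / sigma_reg g c \<epsilon> (v t) x)"
    unfolding Q norm2 HH \<sigma> ..
  have wx: "w t (cinv c y') = h (grad_sq F (y', t)) - tderiv T v t (cinv c y')" if "y' \<in> N" for y'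
    using pde[OF cinv_N[OF that]] representsD[OF s that] by (simp add: w_def wfun_def s_def)
  show "w t x = h (s x) - tderiv T v t x"
    using wx[OF y] sx by (simp add: x_def z_def)
  have nonneg: "0 \<le> grad_sq F z" and inJ: "grad_sq F z \<in> J" using grad_sq_nonneg[OF z] h(4) z by auto
  have h1: "hderiv h (s x) = D 1 K (grad_sq F z)"
    unfolding sx by (rule hderiv_eq[OF h(1) inJ nonneg h(2) Cinf_on_differentiable[OF h(3) inJ]])
  have h2: "hderiv (hderiv h) (s x) = D 1 (D 1 K) (grad_sq F z)"
    unfolding sx by (rule hderiv2_eq[OF h(1) inJ nonneg h(2,3)])
  have eq: "D (0, 1) F x = K (grad_sq F x) - wc x" if x: "x \<in> N \<times> I" "x \<bullet> (0, 1) = z \<bullet> (0, 1)" for x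
  proof -
    obtain y' where x': "x = (y', t)" "y' \<in> N" using x by (cases x) (auto simp: z_def)
    have "tderiv T v t (cinv c y') = D (0, 1) F x"
      unfolding x'(1) by (rule tderiv_eq[OF x'(2) t F represents_v])
    moreover have "h (grad_sq F x) = K (grad_sq F x)" using h(2,4) x(1) grad_sq_nonneg[OF x(1)] by auto
    ultimately show ?thesis
      using wx[OF x'(2)] representsD[OF rw[OF t] x'(2)] by (simp add: x'(1))
  qed
  have L: "Lop g c p \<epsilon> (v t) (w t) x = Leps (p - 2) a F wc z"
    using representsD[OF represents_Lop[OF vt(1,2) wt] y] by (simp add: x_def z_def a_def)
  have T: "tderiv T w t x = D (0, 1) wc z"
    unfolding x_def z_def by (rule tderiv_eq[OF y t wc rw])
  have R: "Ric g c x G G = (\<Sum>j\<in>UNIV. \<Sum>k\<in>UNIV. ric j k z * gr F j z * gr F k z)"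
    unfolding x_def Ric_eq[OF y t(1)] grad z_def ..
  have Ai: "Afield g c p \<epsilon> h (v t) (cinv c y) $ i = drift (p - 2) a K F i z" for i
    unfolding z_def a_def by (rule Afield_eq[OF h y t])
  have A: "ip g c x (grad g c (w t) x) (Afield g c p \<epsilon> h (v t) x)
      = (\<Sum>j\<in>UNIV. d j wc z * drift (p - 2) a K F j z)"
    unfolding x_def ip_grad[OF wt y] Ai by (simp add: z_def)
  have S: "(\<Sum>i\<in>UNIV. \<Sum>j\<in>UNIV. acoef g c p \<epsilon> (v t) i j x * pd c i s x * pd c j s x)
      = grad_sq (grad_sq F) z + (p - 2) * ((\<Sum>k\<in>UNIV. gr F k z * d k (grad_sq F) z)\<^sup>2 / (grad_sq F z + a))"
    unfolding acoef ds grad_sq_def[of "grad_sq F"] gr_def[of "grad_sq F"] power2_eq_square sum_product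
    by (simp add: algebra_simps sum.distrib sum_distrib_left sum_divide_distrib)
  show "Lop g c p \<epsilon> (v t) (w t) x - tderiv T w t x =
              2 * hderiv h (s x) * (Qop g c p \<epsilon> (v t) x + Ric g c x G G)
              + hderiv (hderiv h) (s x)
                * (\<Sum>i\<in>UNIV. \<Sum>j\<in>UNIV. acoef g c p \<epsilon> (v t) i j x * pd c i s x * pd c j s x)
              - 2 * ip g c x (grad g c (w t) x) (Afield g c p \<epsilon> h (v t) x)"
    unfolding L T h1 h2 Q R S A sum_d_drift[OF z]
    by (rule evolution_identity[OF z F pos h(3,4) wc_def eq])
qed

text \<open>A local extension of \<open>h\<close> near \<open>s(z)\<close> is only usable where \<open>s\<close> stays in its domain.\<close>

lemma shrink:
  assumes "open J" "z \<in> N \<times> I" "grad_sq F z \<in> J"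
  shows "\<exists>N' I'. z \<in> N' \<times> I' \<and> chart_patch X \<A> g c N' I' T v F \<and> grad_sq F ` (N' \<times> I') \<subseteq> J"
proof -
  have "open ((N \<times> I) \<inter> grad_sq F -` J)"
    by (rule continuous_open_preimage[OF Cinf_on_continuous W assms(1)]) (simp add: F)
  then obtain N' I' where NI: "open N'" "open I'" "z \<in> N' \<times> I'" "N' \<times> I' \<subseteq> (N \<times> I) \<inter> grad_sq F -` J"
    using assms(2,3) by (elim open_prod_elim[where x = z]) auto
  then have sub: "N' \<subseteq> N" "I' \<subseteq> I" by auto
  have "chart_patch X \<A> g c N' I' T v F"
  proof (intro chart_patch.intro riemannian_manifold_axioms chart_patch_axioms.intro)
    show "Cinf_on N' (\<lambda>y. g c (cinv c y) $ i $ j)" for i j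
      by (rule Cinf_on_subset[OF metric_on_N sub(1)])
    show "Cinf_on (N' \<times> I') F" by (rule Cinf_on_subset[OF F]) (use NI in auto)
  qed (use c N I NI sub F_eq in auto)
  with NI show ?thesis by blast
qed

end

lemma (in riemannian_manifold) exists_chart_patch:
  assumes c: "c \<in> \<A>" and y: "y \<in> cimg c" and t: "t \<in> {0<..T}"
    and v: "smooth_on (cimg c \<times> {0<..T}) (\<lambda>(y, t). v t (cinv c y))"
  shows "\<exists>N I F. (y, t) \<in> N \<times> I \<and> chart_patch X \<A> g c N I T v F"
proof -
  obtain V M where V: "open V" "y \<in> V" "Cinf_on V M" "\<forall>x\<in>V \<inter> cimg c. M x = (g c \<circ> cinv c) x"
    using bspec[OF metric_smooth[OF c, unfolded smooth_on_def] y] unfolding Cinf_on_def by blast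
  have yt: "(y, t) \<in> cimg c \<times> {0<..T}" using y t by simp
  obtain W F where W: "open W" "(y, t) \<in> W" "Cinf_on W F"
    "\<forall>x\<in>W \<inter> cimg c \<times> {0<..T}. F x = (\<lambda>(y, t). v t (cinv c y)) x"
    using bspec[OF v[unfolded smooth_on_def] yt] unfolding Cinf_on_def by blast
  have "open (W \<inter> ((V \<inter> cimg c) \<times> {0<..}))"
    using V(1) W(1) open_cimg[OF c] by (intro open_Int open_Times) auto
  then obtain N I where NI: "open N" "open I" "(y, t) \<in> N \<times> I" "N \<times> I \<subseteq> W \<inter> ((V \<inter> cimg c) \<times> {0<..})"
    using W(2) V(2) y t by (elim open_prod_elim[where x = "(y, t)"]) auto
  then have sub: "N \<subseteq> V" "N \<subseteq> cimg c" "I \<subseteq> {0<..}" "N \<times> I \<subseteq> W" by auto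
  have "chart_patch X \<A> g c N I T v F"
  proof (intro chart_patch.intro riemannian_manifold_axioms chart_patch_axioms.intro)
    show "Cinf_on N (\<lambda>y. g c (cinv c y) $ i $ j)" for i j
    proof (rule Cinf_on_cong[OF NI(1)])
      show "Cinf_on N (\<lambda>y. M y $ i $ j)"
        by (rule Cinf_on_bounded_linear[OF NI(1)
              bounded_linear_compose[OF bounded_linear_vec_nth bounded_linear_vec_nth]
              Cinf_on_subset[OF V(3) sub(1)]])
      show "M y $ i $ j = g c (cinv c y) $ i $ j" if "y \<in> N" for y
        using V(4) subsetD[OF sub(1) that] subsetD[OF sub(2) that] by simp
    qed
    show "Cinf_on (N \<times> I) F" by (rule Cinf_on_subset[OF W(3) sub(4)])
    show "v \<tau> (cinv c y) = F (y, \<tau>)" if "y \<in> N" "\<tau> \<in> I" "\<tau> \<le> T" for y \<tau>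
    proof -
      have "(y, \<tau>) \<in> W \<inter> cimg c \<times> {0<..T}" using that sub by auto
      from bspec[OF W(4) this] show ?thesis by simp
    qed
  qed (use c NI sub in auto)
  with NI show ?thesis by blast
qed

theorem lemma4p4:
  fixes X :: "'a topology" and \<A> :: "('a, 'n::finite) chart set" and g :: "('a, 'n) metric"
    and p \<epsilon> T :: real and h :: "real \<Rightarrow> real" and v :: "real \<Rightarrow> 'a \<Rightarrow> real"
  assumes "riemannian_manifold X \<A> g"
    and "1 < p" and "0 < \<epsilon>" and "0 < T"
    and "smooth_on {0..} h"
    and "\<And>c. c \<in> \<A> \<Longrightarrow> smooth_on (cimg c \<times> {0<..T}) (\<lambda>(y, t). v t (cinv c y))"
    and "\<And>c x t. c \<in> \<A> \<Longrightarrow> x \<in> cdom c \<Longrightarrow> t \<in> {0<..T} \<Longrightarrow>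
           tderiv T v t x = Lop g c p \<epsilon> (v t) (v t) x + h (sfun g c (v t) x)"
  shows "\<forall>c\<in>\<A>.
      smooth_on (cimg c \<times> {0<..T}) (\<lambda>(y, t). Afield g c p \<epsilon> h (v t) (cinv c y)) \<and>
      (\<forall>x\<in>cdom c. \<forall>t\<in>{0<..T}.
         let s = sfun g c (v t);
             w = wfun g c p \<epsilon> v;
             G = grad g c (v t) x;
             H = hess_end g c (v t) x G
         in w t x = h (s x) - tderiv T v t x \<and>
            Qop g c p \<epsilon> (v t) x =
              hess_norm2 g c (v t) x + (p - 2) * (ip g c x H H / sigma_reg g c \<epsilon> (v t) x) \<and>
            Lop g c p \<epsilon> (v t) (w t) x - tderiv T w t x =
              2 * hderiv h (s x) * (Qop g c p \<epsilon> (v t) x + Ric g c x G G)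
              + hderiv (hderiv h) (s x)
                * (\<Sum>i\<in>UNIV. \<Sum>j\<in>UNIV. acoef g c p \<epsilon> (v t) i j x * pd c i s x * pd c j s x)
              - 2 * ip g c x (grad g c (w t) x) (Afield g c p \<epsilon> h (v t) x))"
proof
  fix c assume c: "c \<in> \<A>"
  interpret riemannian_manifold X \<A> g by (rule assms(1))
  let ?grad_sq = "metric_coords.grad_sq (\<lambda>i::'n. (axis i 1, 0::real)) (\<lambda>i j z. ginv g c (cinv c (fst z)) $ i $ j)"
  have patch: "\<exists>N I F J K. (y, t) \<in> N \<times> I \<and> chart_patch X \<A> g c N I T v F \<and> ?grad_sq F ` (N \<times> I) \<subseteq> J
      \<and> open J \<and> (\<forall>r\<in>J. 0 \<le> r \<longrightarrow> h r = K r) \<and> Cinf_on J K"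
    if y: "y \<in> cimg c" and t: "t \<in> {0<..T}" for y t
  proof -
    obtain N I F where NI: "(y, t) \<in> N \<times> I" and P: "chart_patch X \<A> g c N I T v F"
      using exists_chart_patch[OF c y t assms(6)[OF c]] by blast
    have "0 \<le> ?grad_sq F (y, t)" by (rule chart_patch.grad_sq_nonneg[OF P NI])
    then have "?grad_sq F (y, t) \<in> {0..}" by simp
    from bspec[OF assms(5)[unfolded smooth_on_def] this]
    obtain J K where J: "open J" "?grad_sq F (y, t) \<in> J" "Cinf_on J K" "\<forall>r\<in>J \<inter> {0..}. K r = h r"
      unfolding Cinf_on_def by blast
    then have hK: "\<forall>r\<in>J. 0 \<le> r \<longrightarrow> h r = K r" by simp
    show ?thesis using chart_patch.shrink[OF P J(1) NI J(2)] J(1,3) hK by blast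
  qed
  show "smooth_on (cimg c \<times> {0<..T}) (\<lambda>(y, t). Afield g c p \<epsilon> h (v t) (cinv c y)) \<and>
      (\<forall>x\<in>cdom c. \<forall>t\<in>{0<..T}.
         let s = sfun g c (v t);
             w = wfun g c p \<epsilon> v;
             G = grad g c (v t) x;
             H = hess_end g c (v t) x G
         in w t x = h (s x) - tderiv T v t x \<and>
            Qop g c p \<epsilon> (v t) x =
              hess_norm2 g c (v t) x + (p - 2) * (ip g c x H H / sigma_reg g c \<epsilon> (v t) x) \<and>
            Lop g c p \<epsilon> (v t) (w t) x - tderiv T w t x =
              2 * hderiv h (s x) * (Qop g c p \<epsilon> (v t) x + Ric g c x G G)
              + hderiv (hderiv h) (s x)
                * (\<Sum>i\<in>UNIV. \<Sum>j\<in>UNIV. acoef g c p \<epsilon> (v t) i j x * pd c i s x * pd c j s x)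
              - 2 * ip g c x (grad g c (w t) x) (Afield g c p \<epsilon> h (v t) x))"
  proof (intro conjI ballI)
    show "smooth_on (cimg c \<times> {0<..T}) (\<lambda>(y, t). Afield g c p \<epsilon> h (v t) (cinv c y))"
      unfolding smooth_on_def
    proof
      fix z assume "z \<in> cimg c \<times> {0<..T}"
      then obtain y t where z: "z = (y, t)" and yt: "y \<in> cimg c" "t \<in> {0<..T}" by auto
      from patch[OF yt] obtain N I F J K where
        NI: "(y, t) \<in> N \<times> I" and P: "chart_patch X \<A> g c N I T v F" and J: "?grad_sq F ` (N \<times> I) \<subseteq> J"
        "open J" "\<forall>r\<in>J. 0 \<le> r \<longrightarrow> h r = K r" "Cinf_on J K" by blast
      show "\<exists>W B. open W \<and> z \<in> W \<and> (\<forall>k. Ck_on k W B) \<and>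
          (\<forall>x\<in>W \<inter> cimg c \<times> {0<..T}. B x = (\<lambda>(y, t). Afield g c p \<epsilon> h (v t) (cinv c y)) x)"
        unfolding z
        by (rule chart_patch.Afield_smooth_near[OF P J(2) _ J(4,1) assms(3) NI]) (use J(3) in auto)
    qed
  next
    fix x t assume x: "x \<in> cdom c" and t: "t \<in> {0<..T}"
    define y where "y = cmap c x"
    have y: "y \<in> cimg c" and xy: "x = cinv c y" using x by (auto simp: y_def cinv_cmap[OF c])
    from patch[OF y t] obtain N I F J K where
      NI: "(y, t) \<in> N \<times> I" and P: "chart_patch X \<A> g c N I T v F" and J: "?grad_sq F ` (N \<times> I) \<subseteq> J"
      "open J" "\<forall>r\<in>J. 0 \<le> r \<longrightarrow> h r = K r" "Cinf_on J K" by blast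
    have N: "y \<in> N" and I: "t \<in> I" "t \<le> T" using NI t by auto
    have hK: "h r = K r" if "r \<in> J" "0 \<le> r" for r using J(3) that by blast
    note I' = chart_patch.identity_at_point[where p = p, OF P J(2) hK J(4,1) assms(3) N I assms(7)[OF c _ t]]
    show "let s = sfun g c (v t);
             w = wfun g c p \<epsilon> v;
             G = grad g c (v t) x;
             H = hess_end g c (v t) x G
         in w t x = h (s x) - tderiv T v t x \<and>
            Qop g c p \<epsilon> (v t) x =
              hess_norm2 g c (v t) x + (p - 2) * (ip g c x H H / sigma_reg g c \<epsilon> (v t) x) \<and>
            Lop g c p \<epsilon> (v t) (w t) x - tderiv T w t x =
              2 * hderiv h (s x) * (Qop g c p \<epsilon> (v t) x + Ric g c x G G)
              + hderiv (hderiv h) (s x)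
                * (\<Sum>i\<in>UNIV. \<Sum>j\<in>UNIV. acoef g c p \<epsilon> (v t) i j x * pd c i s x * pd c j s x)
              - 2 * ip g c x (grad g c (w t) x) (Afield g c p \<epsilon> h (v t) x)"
      unfolding Let_def xy by (intro conjI I')
  qed
qed

end
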